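(* Let $\mathsf h$ be an arbitrary complex number. The Jordanian algebra $\mathcal U_{\mathsf h}(sl(3))$ is an associative algebra over $\mathbb C$ generated by $H_1,H_2,H_3,E_1,E_2,T,T^{-1},F_1,F_2,F_3$, satisfying the following commutation relations (A) and (B). (A) $$TT^{-1}=T^{-1}T=1,\quad [H_3,T]=T^2-1,\quad [H_3,T^{-1}]=T^{-2}-1,$$ $$[T,F_3]=\tfrac{\mathsf h}{2}(H_3T+TH_3),\quad [T^{-1},F_3]=-\tfrac{\mathsf h}{2}(H_3T^{-1}+T^{-1}H_3),$$ $$[H_3,F_3]=-\tfrac12\bigl(TF_3+F_3T+T^{-1}F_3+F_3T^{-1}\bigr).$$ (B) $$[H_1,H_2]=0,\quad [H_1,T^{-1}H_3]=[H_2,T^{-1}H_3]=0,$$ $$[H_1,E_1]=2E_1,\quad [H_2,E_2]=2E_2,\quad [H_1,E_2]=-E_2,\quad [H_2,E_1]=-E_1,$$ $$[T^{-1}H_3,E_1]=E_1,\quad [T^{-1}H_3,E_2]=E_2,$$ $$[H_1,F_1]=-2F_1+\mathsf hE_2T^{-1}H_3,\quad [H_2,F_2]=-2F_2-\mathsf hE_1T^{-1}H_3,$$ $$[H_1,F_2]=F_2-\mathsf hE_1T^{-1}H_3,\quad [H_2,F_1]=F_1+\mathsf hE_2T^{-1}H_3,$$ $$[TH_3,F_1]=-T^2F_1,\quad [TH_3,F_2]=-T^2F_2,$$ $$[T^{-1}E_1,F_1]=\tfrac12(T+T^{-1})H_1+\tfrac12(T-T^{-1})H_2,$$ $$[T^{-1}E_2,F_2]=\tfrac12(T+T^{-1})H_2+\tfrac12(T-T^{-1})H_1,$$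 $$[T^{-1}E_1,F_2]=0,\quad [T^{-1}E_2,F_1]=0,\quad [E_1,E_2]=\tfrac{1}{2\mathsf h}(T^2-1),$$ $$[TF_2,TF_1]=T\Bigl(F_3-\tfrac{\mathsf h}{2}H_3TH_3-\tfrac{\mathsf h}{8}(T-T^{-1})\Bigr),$$ $$[TH_1,T]=\tfrac12(T^2-1),\quad [TH_1,T^{-1}]=\tfrac12(T^{-2}-1),$$ $$[TH_2,T]=\tfrac12(T^2-1),\quad [TH_2,T^{-1}]=\tfrac12(T^{-2}-1),$$ $$[H_i,F_3]=-\tfrac14T^{-1}\bigl(TF_3+F_3T+T^{-1}F_3+F_3T^{-1}\bigr)-\tfrac{\mathsf h}{4}T^{-1}H_3^2-\tfrac{\mathsf h}{4}H_3T^{-1}H_3\quad(i=1,2),$$ $$[E_1,T]=[E_1,T^{-1}]=[E_2,T]=[E_2,T^{-1}]=0,$$ $$[F_1,T]=\mathsf hTE_2,\quad [F_1,T^{-1}]=-\mathsf hT^{-1}E_2,\quad [F_2,T]=-\mathsf hTE_1,\quad [F_2,T^{-1}]=\mathsf hT^{-1}E_1,$$ $$[E_1,F_3]=-\tfrac12(TF_2+F_2T),\quad [E_2,F_3]=\tfrac12(TF_1+F_1T),$$ $$[F_1,F_3]=\mathsf hTF_1-\mathsf hE_2F_3+\tfrac{\mathsf h^2}{4}TE_2,\quad [F_2,F_3]=\mathsf hTF_2+\mathsf hE_1F_3-\tfrac{\mathsf h^2}{4}TE_1.$$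
   Context: Here $[a,b]=ab-ba$. Background: let $sl(3)$ over $\mathbb C$ have classical Chevalley generators $h_i,e_i,f_i$ ($i=1,2$), and put $h_3=h_1+h_2$, $e_3=e_1e_2-e_2e_1$, $f_3=f_2f_1-f_1f_2$. The relations were arrived at from the following expressions in the classical generators (a nonlinear map), which are regarded as one particular realization of $\mathcal U_{\mathsf h}(sl(3))$ (other maps may also be considered): $$T^{\pm1}=\pm\mathsf he_3+\sqrt{1+\mathsf h^2e_3^2},\qquad H_3=\sqrt{1+\mathsf h^2e_3^2}\,h_3,\qquad F_3=f_3-\tfrac{\mathsf h^2}{4}e_3(h_3^2-1),$$ $$E_1=T^{1/2}e_1,\qquad E_2=T^{1/2}e_2,$$ $$F_1=T^{-1/2}\bigl(f_1+\tfrac{\mathsf h}{2}e_2Th_3\bigr),\qquad F_2=T^{-1/2}\bigl(f_2-\tfrac{\mathsf h}{2}e_1Th_3\bigr),$$ $$H_1=h_1-\tfrac{\mathsf h}{2}e_3T^{-1}h_3,\qquad H_2=h_2-\tfrac{\mathsf h}{2}e_3T^{-1}h_3.$$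
   Formalization: The relation for [E1,E2] is stated as 2h[E1,E2]=T^2-1, since 1/(2h) is undefined at h=0; the nonlinear map is shown to satisfy the relations with h/2 for the printed coefficient h of TF_1, TF_2 in [F1,F3], [F2,F3], as the printed one fails for it when h≠0. *)

theory Defs
  imports
    "HOL-Library.Poly_Mapping"
    "HOL-Computational_Algebra.Formal_Power_Series"
    "HOL-Algebra.QuotRing"
    "HOL-Algebra.Subrings"
begin

section \<open>Associative complex algebras\<close>

text \<open>The library locale \<^locale>\<open>algebra\<close> is for commutative algebras only.\<close>

definition complex_ring :: "complex ring" where
  "complex_ring = \<lparr>carrier = UNIV, mult = (*), one = 1, zero = 0, add = (+)\<rparr>"

locale assoc_algebra = C?: module complex_ring A + A?: ring A for A (structure) +
  assumes smult_mult_left: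
      "x \<in> carrier A \<Longrightarrow> y \<in> carrier A \<Longrightarrow> (c \<odot> x) \<otimes> y = c \<odot> (x \<otimes> y)"
    and smult_mult_right:
      "x \<in> carrier A \<Longrightarrow> y \<in> carrier A \<Longrightarrow> x \<otimes> (c \<odot> y) = c \<odot> (x \<otimes> y)"

definition algebra_hom ::
  "(complex, 'a, 'm) module_scheme \<Rightarrow> (complex, 'b, 'n) module_scheme \<Rightarrow> ('a \<Rightarrow> 'b) set" where
  "algebra_hom A B = {\<phi> \<in> ring_hom A B.
     \<forall>c. \<forall>a \<in> carrier A. \<phi> (c \<odot>\<^bsub>A\<^esub> a) = c \<odot>\<^bsub>B\<^esub> \<phi> a}"

definition generates_algebra :: "(complex, 'a, 'm) module_scheme \<Rightarrow> 'a set \<Rightarrow> bool" where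
  "generates_algebra A S \<longleftrightarrow> S \<subseteq> carrier A \<and>
     (\<forall>B. subring B A \<and> (\<forall>c. \<forall>b \<in> B. c \<odot>\<^bsub>A\<^esub> b \<in> B) \<and> S \<subseteq> B \<longrightarrow> B = carrier A)"

definition quotient_algebra ::
  "(complex, 'a, 'm) module_scheme \<Rightarrow> 'a set \<Rightarrow> (complex, 'a set) module" where
  "quotient_algebra A I =
     \<lparr>carrier = carrier (A Quot I), mult = mult (A Quot I), one = one (A Quot I),
      zero = zero (A Quot I), add = add (A Quot I),
      smult = (\<lambda>c X. \<Union>a \<in> X. I +>\<^bsub>A\<^esub> (c \<odot>\<^bsub>A\<^esub> a))\<rparr>"

text \<open>Words under concatenation form a monoid; additive notation is what
  \<^type>\<open>poly_mapping\<close> requires of its exponents. Its multiplication is then that of the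
  noncommutative polynomials.\<close>

instantiation list :: (type) monoid_add
begin
definition zero_list_def: "0 = []"
definition plus_list_def: "xs + ys = xs @ ys"
instance by standard (simp_all add: zero_list_def plus_list_def)
end

definition free_algebra :: "(complex, 'g list \<Rightarrow>\<^sub>0 complex) module" where
  "free_algebra =
     \<lparr>carrier = UNIV, mult = (*), one = 1, zero = 0, add = (+),
      smult = (\<lambda>c p. Poly_Mapping.single [] c * p)\<rparr>"

definition free_gen :: "'g \<Rightarrow> 'g list \<Rightarrow>\<^sub>0 complex" where
  "free_gen g = Poly_Mapping.single [g] 1"

definition endomorphism_algebra ::
  "(complex \<Rightarrow> 'v \<Rightarrow> 'v) \<Rightarrow> (complex, 'v::ab_group_add \<Rightarrow> 'v) module" where
  "endomorphism_algebra scale =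
     \<lparr>carrier = {f. Vector_Spaces.linear scale scale f}, mult = (\<circ>), one = id,
      zero = (\<lambda>v. 0), add = (\<lambda>f g v. f v + g v), smult = (\<lambda>c f v. scale c (f v))\<rparr>"

section \<open>The defining relations\<close>

datatype generator = GH1 | GH2 | GH3 | GE1 | GE2 | GT | GTinv | GF1 | GF2 | GF3

context
  fixes A :: "(complex, 'a, 'm) module_scheme" (structure)
begin

definition comm :: "'a \<Rightarrow> 'a \<Rightarrow> 'a" where
  "comm a b = a \<otimes> b \<ominus> b \<otimes> a"

definition relations_A :: "complex \<Rightarrow> (generator \<Rightarrow> 'a) \<Rightarrow> ('a \<times> 'a) list" where
  "relations_A h x =
    (let H3 = x GH3; T = x GT; T' = x GTinv; F3 = x GF3 in
     [(T \<otimes> T', \<one>),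
      (T' \<otimes> T, \<one>),
      (comm H3 T, T [^] (2::nat) \<ominus> \<one>),
      (comm H3 T', T' [^] (2::nat) \<ominus> \<one>),
      (comm T F3, (h/2) \<odot> (H3 \<otimes> T \<oplus> T \<otimes> H3)),
      (comm T' F3, (-h/2) \<odot> (H3 \<otimes> T' \<oplus> T' \<otimes> H3)),
      (comm H3 F3, (-1/2) \<odot> (T \<otimes> F3 \<oplus> F3 \<otimes> T \<oplus> T' \<otimes> F3 \<oplus> F3 \<otimes> T'))])"

text \<open>The relation \<open>[E1, E2] = (1/(2h)) (T^2 - 1)\<close> is written with the denominator cleared,
  so that it also makes sense for \<open>h = 0\<close>, where HOL would read \<open>1/(2h)\<close> as \<open>0\<close>.
  The two relations for \<open>[F1, F3]\<close> and \<open>[F2, F3]\<close> are in \<open>relations_FF\<close> below.\<close>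

definition relations_B :: "complex \<Rightarrow> (generator \<Rightarrow> 'a) \<Rightarrow> ('a \<times> 'a) list" where
  "relations_B h x =
    (let H1 = x GH1; H2 = x GH2; H3 = x GH3; E1 = x GE1; E2 = x GE2;
         T = x GT; T' = x GTinv; F1 = x GF1; F2 = x GF2; F3 = x GF3;
         HF = (-1/4) \<odot> (T' \<otimes> (T \<otimes> F3 \<oplus> F3 \<otimes> T \<oplus> T' \<otimes> F3 \<oplus> F3 \<otimes> T'))
              \<ominus> (h/4) \<odot> (T' \<otimes> H3 [^] (2::nat))
              \<ominus> (h/4) \<odot> (H3 \<otimes> T' \<otimes> H3) in
     [(comm H1 H2, \<zero>),
      (comm H1 (T' \<otimes> H3), \<zero>),
      (comm H2 (T' \<otimes> H3), \<zero>),
      (comm H1 E1, 2 \<odot> E1),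
      (comm H2 E2, 2 \<odot> E2),
      (comm H1 E2, \<ominus> E2),
      (comm H2 E1, \<ominus> E1),
      (comm (T' \<otimes> H3) E1, E1),
      (comm (T' \<otimes> H3) E2, E2),
      (comm H1 F1, (-2) \<odot> F1 \<oplus> h \<odot> (E2 \<otimes> T' \<otimes> H3)),
      (comm H2 F2, (-2) \<odot> F2 \<ominus> h \<odot> (E1 \<otimes> T' \<otimes> H3)),
      (comm H1 F2, F2 \<ominus> h \<odot> (E1 \<otimes> T' \<otimes> H3)),
      (comm H2 F1, F1 \<oplus> h \<odot> (E2 \<otimes> T' \<otimes> H3)),
      (comm (T \<otimes> H3) F1, \<ominus> (T [^] (2::nat) \<otimes> F1)),
      (comm (T \<otimes> H3) F2, \<ominus> (T [^] (2::nat) \<otimes> F2)),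
      (comm (T' \<otimes> E1) F1, (1/2) \<odot> ((T \<oplus> T') \<otimes> H1) \<oplus> (1/2) \<odot> ((T \<ominus> T') \<otimes> H2)),
      (comm (T' \<otimes> E2) F2, (1/2) \<odot> ((T \<oplus> T') \<otimes> H2) \<oplus> (1/2) \<odot> ((T \<ominus> T') \<otimes> H1)),
      (comm (T' \<otimes> E1) F2, \<zero>),
      (comm (T' \<otimes> E2) F1, \<zero>),
      ((2 * h) \<odot> comm E1 E2, T [^] (2::nat) \<ominus> \<one>),
      (comm (T \<otimes> F2) (T \<otimes> F1),
        T \<otimes> (F3 \<ominus> (h/2) \<odot> (H3 \<otimes> T \<otimes> H3) \<ominus> (h/8) \<odot> (T \<ominus> T'))),
      (comm (T \<otimes> H1) T, (1/2) \<odot> (T [^] (2::nat) \<ominus> \<one>)),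
      (comm (T \<otimes> H1) T', (1/2) \<odot> (T' [^] (2::nat) \<ominus> \<one>)),
      (comm (T \<otimes> H2) T, (1/2) \<odot> (T [^] (2::nat) \<ominus> \<one>)),
      (comm (T \<otimes> H2) T', (1/2) \<odot> (T' [^] (2::nat) \<ominus> \<one>)),
      (comm H1 F3, HF),
      (comm H2 F3, HF),
      (comm E1 T, \<zero>),
      (comm E1 T', \<zero>),
      (comm E2 T, \<zero>),
      (comm E2 T', \<zero>),
      (comm F1 T, h \<odot> (T \<otimes> E2)),
      (comm F1 T', (-h) \<odot> (T' \<otimes> E2)),
      (comm F2 T, (-h) \<odot> (T \<otimes> E1)),
      (comm F2 T', h \<odot> (T' \<otimes> E1)),
      (comm E1 F3, (-1/2) \<odot> (T \<otimes> F2 \<oplus> F2 \<otimes> T)),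
      (comm E2 F3, (1/2) \<odot> (T \<otimes> F1 \<oplus> F1 \<otimes> T))])"

text \<open>The relations as usually printed have \<open>k = h\<close>. The nonlinear map below satisfies all
  other relations as they stand, but these two only for \<open>k = h/2\<close> (if \<open>h\<close> is nonzero, \<open>k = h\<close>
  fails for it already in the three-dimensional representation).\<close>

definition relations_FF :: "complex \<Rightarrow> complex \<Rightarrow> (generator \<Rightarrow> 'a) \<Rightarrow> ('a \<times> 'a) list" where
  "relations_FF h k x =
    (let E1 = x GE1; E2 = x GE2; T = x GT; F1 = x GF1; F2 = x GF2; F3 = x GF3 in
     [(comm F1 F3, k \<odot> (T \<otimes> F1) \<ominus> h \<odot> (E2 \<otimes> F3) \<oplus> (h^2/4) \<odot> (T \<otimes> E2)),
      (comm F2 F3, k \<odot> (T \<otimes> F2) \<oplus> h \<odot> (E1 \<otimes> F3) \<ominus> (h^2/4) \<odot> (T \<otimes> E1))])"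

definition jordanian_relations ::
  "complex \<Rightarrow> complex \<Rightarrow> (generator \<Rightarrow> 'a) \<Rightarrow> ('a \<times> 'a) list" where
  "jordanian_relations h k x = relations_A h x @ relations_B h x @ relations_FF h k x"

definition satisfies_jordanian :: "complex \<Rightarrow> complex \<Rightarrow> (generator \<Rightarrow> 'a) \<Rightarrow> bool" where
  "satisfies_jordanian h k x \<longleftrightarrow>
     range x \<subseteq> carrier A \<and> (\<forall>(l, r) \<in> set (jordanian_relations h k x). l = r)"

section \<open>Classical generators and the nonlinear map\<close>

definition chevalley_sl3 :: "'a \<Rightarrow> 'a \<Rightarrow> 'a \<Rightarrow> 'a \<Rightarrow> 'a \<Rightarrow> 'a \<Rightarrow> bool" where
  "chevalley_sl3 h1 h2 e1 e2 f1 f2 \<longleftrightarrow>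
     {h1, h2, e1, e2, f1, f2} \<subseteq> carrier A \<and>
     comm h1 h2 = \<zero> \<and>
     comm h1 e1 = 2 \<odot> e1 \<and> comm h1 e2 = \<ominus> e2 \<and>
     comm h2 e1 = \<ominus> e1 \<and> comm h2 e2 = 2 \<odot> e2 \<and>
     comm h1 f1 = (-2) \<odot> f1 \<and> comm h1 f2 = f2 \<and>
     comm h2 f1 = f1 \<and> comm h2 f2 = (-2) \<odot> f2 \<and>
     comm e1 f1 = h1 \<and> comm e1 f2 = \<zero> \<and>
     comm e2 f1 = \<zero> \<and> comm e2 f2 = h2 \<and>
     comm e1 (comm e1 e2) = \<zero> \<and> comm e2 (comm e2 e1) = \<zero> \<and>
     comm f1 (comm f1 f2) = \<zero> \<and> comm f2 (comm f2 f1) = \<zero>"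

text \<open>Power series in the variable \<open>e3\<close>.\<close>

definition sqrt_series :: "complex \<Rightarrow> complex fps" where
  "sqrt_series h = fps_compose (fps_binomial (1/2)) (fps_const (h^2) * fps_X^2)"

definition T_series :: "complex \<Rightarrow> complex fps" where
  "T_series h = fps_const h * fps_X + sqrt_series h"

definition Tinv_series :: "complex \<Rightarrow> complex fps" where
  "Tinv_series h = - fps_const h * fps_X + sqrt_series h"

definition T_half_series :: "complex \<Rightarrow> complex fps" where
  "T_half_series h = fps_compose (fps_binomial (1/2)) (T_series h - 1)"

definition Tinv_half_series :: "complex \<Rightarrow> complex fps" where
  "Tinv_half_series h = fps_compose (fps_binomial (-1/2)) (T_series h - 1)"

text \<open>\<open>\<psi> S\<close> stands for the value of the power series \<open>S\<close> at \<open>e3\<close>.\<close>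

fun nonlinear_map ::
  "complex \<Rightarrow> (complex fps \<Rightarrow> 'a) \<Rightarrow> 'a \<Rightarrow> 'a \<Rightarrow> 'a \<Rightarrow> 'a \<Rightarrow> 'a \<Rightarrow> 'a \<Rightarrow> generator \<Rightarrow> 'a" where
  "nonlinear_map h \<psi> h1 h2 e1 e2 f1 f2 GT = \<psi> (T_series h)"
| "nonlinear_map h \<psi> h1 h2 e1 e2 f1 f2 GTinv = \<psi> (Tinv_series h)"
| "nonlinear_map h \<psi> h1 h2 e1 e2 f1 f2 GH3 = \<psi> (sqrt_series h) \<otimes> (h1 \<oplus> h2)"
| "nonlinear_map h \<psi> h1 h2 e1 e2 f1 f2 GF3 =
     comm f2 f1 \<ominus> (h^2/4) \<odot> (comm e1 e2 \<otimes> ((h1 \<oplus> h2) [^] (2::nat) \<ominus> \<one>))"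
| "nonlinear_map h \<psi> h1 h2 e1 e2 f1 f2 GE1 = \<psi> (T_half_series h) \<otimes> e1"
| "nonlinear_map h \<psi> h1 h2 e1 e2 f1 f2 GE2 = \<psi> (T_half_series h) \<otimes> e2"
| "nonlinear_map h \<psi> h1 h2 e1 e2 f1 f2 GF1 =
     \<psi> (Tinv_half_series h) \<otimes> (f1 \<oplus> (h/2) \<odot> (e2 \<otimes> \<psi> (T_series h) \<otimes> (h1 \<oplus> h2)))"
| "nonlinear_map h \<psi> h1 h2 e1 e2 f1 f2 GF2 =
     \<psi> (Tinv_half_series h) \<otimes> (f2 \<ominus> (h/2) \<odot> (e1 \<otimes> \<psi> (T_series h) \<otimes> (h1 \<oplus> h2)))"
| "nonlinear_map h \<psi> h1 h2 e1 e2 f1 f2 GH1 =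
     h1 \<ominus> (h/2) \<odot> (comm e1 e2 \<otimes> \<psi> (Tinv_series h) \<otimes> (h1 \<oplus> h2))"
| "nonlinear_map h \<psi> h1 h2 e1 e2 f1 f2 GH2 =
     h2 \<ominus> (h/2) \<odot> (comm e1 e2 \<otimes> \<psi> (Tinv_series h) \<otimes> (h1 \<oplus> h2))"

end

definition locally_nilpotent :: "('v::ab_group_add \<Rightarrow> 'v) \<Rightarrow> bool" where
  "locally_nilpotent a \<longleftrightarrow> (\<forall>v. \<exists>n. (a ^^ n) v = 0)"

text \<open>The sum is finite at each vector if \<open>a\<close> is locally nilpotent.\<close>

definition series_at ::
  "(complex \<Rightarrow> 'v \<Rightarrow> 'v) \<Rightarrow> ('v::ab_group_add \<Rightarrow> 'v) \<Rightarrow> complex fps \<Rightarrow> 'v \<Rightarrow> 'v" where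
  "series_at scale a S v = (\<Sum>k | (a ^^ k) v \<noteq> 0. scale (fps_nth S k) ((a ^^ k) v))"

section \<open>The Jordanian algebra\<close>

definition jordanian_ideal :: "complex \<Rightarrow> complex \<Rightarrow> (generator list \<Rightarrow>\<^sub>0 complex) set" where
  "jordanian_ideal h k = genideal free_algebra
     {l - r | l r. (l, r) \<in> set (jordanian_relations free_algebra h k free_gen)}"

definition jordanian_algebra ::
  "complex \<Rightarrow> complex \<Rightarrow> (complex, (generator list \<Rightarrow>\<^sub>0 complex) set) module" where
  "jordanian_algebra h k = quotient_algebra free_algebra (jordanian_ideal h k)"

definition jordanian_gen ::
  "complex \<Rightarrow> complex \<Rightarrow> generator \<Rightarrow> (generator list \<Rightarrow>\<^sub>0 complex) set" where
  "jordanian_gen h k g = jordanian_ideal h k +>\<^bsub>free_algebra\<^esub> free_gen g"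

end

theory Submission
  imports Defs
begin

text \<open>
  The first half is the universal property of a quotient of the free algebra. For the second half,
  let \<open>e3\<close> be locally nilpotent, so that power series in \<open>e3\<close> act as operators.
  Each classical generator acts on such a series as a derivation, e.g. \<open>[f1, S(e3)] = S'(e3) e2\<close>,
  and so every product of series and generators has a PBW form, a combination of ordered words
  with power series as left coefficients. In each relation the two sides have the same
  coefficients: the derivatives of the series that occur are polynomials in these series and
  \<open>1/s\<close>, where \<open>s\<close> is the square root of \<open>1 + h^2 X^2\<close>, and the
  equality of coefficients is then a consequence of the algebraic relations between the series.
\<close>

section \<open>Associative algebras and their quotients\<close>

lemma complex_ring_simps [simp]:
  "carrier complex_ring = UNIV" "mult complex_ring = (*)" "one complex_ring = 1"
  "zero complex_ring = 0" "add complex_ring = (+)"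
  by (simp_all add: complex_ring_def)

lemma cring_complex_ring: "cring complex_ring"
proof (rule cringI)
  show "abelian_group complex_ring"
    by (rule abelian_groupI) (auto simp: algebra_simps intro: exI[of _ "- _"])
  show "comm_monoid complex_ring"
    by (rule comm_monoidI) (auto simp: algebra_simps)
qed (auto simp: algebra_simps)

lemma assoc_algebraI:
  fixes A :: "(complex, 'a, 'm) module_scheme" (structure)
  assumes "ring A"
    and "\<And>c x. x \<in> carrier A \<Longrightarrow> c \<odot> x \<in> carrier A"
    and "\<And>c d x. x \<in> carrier A \<Longrightarrow> (c + d) \<odot> x = c \<odot> x \<oplus> d \<odot> x"
    and "\<And>c x y. x \<in> carrier A \<Longrightarrow> y \<in> carrier A \<Longrightarrow> c \<odot> (x \<oplus> y) = c \<odot> x \<oplus> c \<odot> y"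
    and "\<And>c d x. x \<in> carrier A \<Longrightarrow> (c * d) \<odot> x = c \<odot> (d \<odot> x)"
    and "\<And>x. x \<in> carrier A \<Longrightarrow> 1 \<odot> x = x"
    and "\<And>c x y. x \<in> carrier A \<Longrightarrow> y \<in> carrier A \<Longrightarrow> (c \<odot> x) \<otimes> y = c \<odot> (x \<otimes> y)"
    and "\<And>c x y. x \<in> carrier A \<Longrightarrow> y \<in> carrier A \<Longrightarrow> x \<otimes> (c \<odot> y) = c \<odot> (x \<otimes> y)"
  shows "assoc_algebra A"
proof -
  have "module complex_ring A"
    using assms by (intro moduleI cring_complex_ring) (simp_all add: ring.is_abelian_group)
  with assms show ?thesis
    by (simp add: assoc_algebra_def assoc_algebra_axioms_def)
qed

section \<open>Quotients of an algebra by two-sided ideals\<close>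

lemma quotient_algebra_simps:
  "carrier (quotient_algebra A I) = carrier (A Quot I)"
  "mult (quotient_algebra A I) = mult (A Quot I)" "one (quotient_algebra A I) = one (A Quot I)"
  "zero (quotient_algebra A I) = zero (A Quot I)" "add (quotient_algebra A I) = add (A Quot I)"
  by (simp_all add: quotient_algebra_def)

context assoc_algebra
begin

lemmas smult_simps = C.smult_l_distr[simplified] C.smult_r_distr[simplified]
  C.smult_assoc1[simplified] C.smult_one[simplified]

lemma smult_zero_left: "x \<in> carrier A \<Longrightarrow> 0 \<odot> x = \<zero>"
  using C.smult_l_null by simp

text \<open>Scaling by \<open>c\<close> is left multiplication by \<open>c\<close> times the unit,
  so a two-sided ideal of the ring is automatically a subspace.\<close>

lemma ideal_smult_closed:
  assumes "ideal I A" "a \<in> I"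
  shows "c \<odot> a \<in> I"
proof -
  interpret ideal I A by fact
  have "c \<odot> a = (c \<odot> \<one>) \<otimes> a"
    using assms by (simp add: smult_mult_left a_Hcarr)
  then show ?thesis
    using assms by (simp add: I_l_closed)
qed

context
  fixes I
  assumes I: "ideal I A"
begin

interpretation ideal I A by (rule I)

lemma quotient_carrier: "carrier (quotient_algebra A I) = (\<lambda>a. I +> a) ` carrier A"
  by (auto simp: quotient_algebra_simps FactRing_def A_RCOSETS_def')

lemma quotient_coset:
  assumes "a \<in> carrier A" "b \<in> carrier A"
  shows "I +> a \<in> carrier (quotient_algebra A I)"
    "(I +> a) \<otimes>\<^bsub>quotient_algebra A I\<^esub> (I +> b) = I +> (a \<otimes> b)"
    "(I +> a) \<oplus>\<^bsub>quotient_algebra A I\<^esub> (I +> b) = I +> (a \<oplus> b)"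
  using assms ring_hom_mult[OF rcos_ring_hom] ring_hom_add[OF rcos_ring_hom]
  by (auto simp: quotient_carrier) (simp_all add: quotient_algebra_simps)

lemma quotient_one: "\<one>\<^bsub>quotient_algebra A I\<^esub> = I +> \<one>"
  using ring_hom_one[OF rcos_ring_hom] by (simp add: quotient_algebra_simps)

text \<open>The scalar multiplication of \<open>quotient_algebra\<close> is a union over all
  representatives. All of them contribute the same coset, because two representatives differ by an
  element of \<open>I\<close> and \<open>I\<close> is closed under scaling.\<close>

lemma quotient_smult:
  assumes "a \<in> carrier A"
  shows "c \<odot>\<^bsub>quotient_algebra A I\<^esub> (I +> a) = I +> (c \<odot> a)"
proof -
  have const: "I +> (c \<odot> b) = I +> (c \<odot> a)" if "b \<in> I +> a" for b
  proof -
    from that obtain i where i: "i \<in> I" "b = i \<oplus> a"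
      by (auto simp: a_r_coset_def')
    then have "c \<odot> b = c \<odot> i \<oplus> c \<odot> a"
      using assms by (simp add: C.smult_r_distr a_Hcarr)
    then have "c \<odot> b \<in> I +> (c \<odot> a)"
      using ideal_smult_closed[OF I i(1)] by (auto simp: a_r_coset_def')
    then show ?thesis
      using assms using a_repr_independence[of "c \<odot> b" I "c \<odot> a"] a_subgroup by (simp add: additive_subgroup.a_subgroup)
  qed
  have "(\<Union>b\<in>I +> a. I +> (c \<odot> b)) = I +> (c \<odot> a)"
    by (rule UN_constant_eq[OF a_rcos_self[OF assms]]) (rule ballI, rule const)
  then show ?thesis
    by (simp add: quotient_algebra_def)
qed

text \<open>The quotient algebra shares its ring operations with \<open>A Quot I\<close> but is a
  different record, so the ring axioms are carried over one operation at a time.\<close>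

lemma ring_quotient: "ring (quotient_algebra A I)"
proof -
  interpret Q: ring "A Quot I" by (rule quotient_is_ring)
  show ?thesis
  proof (rule ringI)
    show "abelian_group (quotient_algebra A I)"
    proof (rule abelian_groupI; simp only: quotient_algebra_simps)
      fix X assume X: "X \<in> carrier (A Quot I)"
      show "\<exists>Y\<in>carrier (A Quot I). Y \<oplus>\<^bsub>A Quot I\<^esub> X = \<zero>\<^bsub>A Quot I\<^esub>"
        by (rule bexI, rule Q.l_neg[OF X], rule Q.a_inv_closed[OF X])
    qed (rule Q.a_closed Q.zero_closed Q.a_assoc Q.a_comm Q.l_zero; assumption)+
    show "Group.monoid (quotient_algebra A I)"
      by (rule monoidI) (auto simp: quotient_algebra_simps Q.m_assoc)
  qed (auto simp: quotient_algebra_simps Q.l_distr Q.r_distr)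
qed

lemma assoc_algebra_quotient: "assoc_algebra (quotient_algebra A I)"
proof (rule assoc_algebraI)
  show "ring (quotient_algebra A I)" by (rule ring_quotient)
qed (auto simp: quotient_carrier quotient_coset quotient_smult smult_mult_left smult_mult_right smult_simps)

lemma coset_algebra_hom: "(\<lambda>a. I +> a) \<in> algebra_hom A (quotient_algebra A I)"
  by (auto simp: algebra_hom_def quotient_coset quotient_one quotient_smult intro!: ring_hom_memI)

end

end

section \<open>The free algebra\<close>

lemma free_algebra_simps [simp]:
  "carrier free_algebra = UNIV" "mult free_algebra = (*)" "one free_algebra = 1"
  "zero free_algebra = 0" "add free_algebra = (+)"
  by (simp_all add: free_algebra_def)

lemma free_algebra_smult: "c \<odot>\<^bsub>free_algebra\<^esub> p = Poly_Mapping.single [] c * p"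
  by (simp add: free_algebra_def)

text \<open>A finitely supported function is the finite sum of its one-term parts, so statements
  that respect sums need checking on single words only.\<close>

lemma poly_mapping_induct_single [case_names single add]:
  assumes "\<And>w c. P (Poly_Mapping.single w c)" and "\<And>p q. P p \<Longrightarrow> P q \<Longrightarrow> P (p + q)"
  shows "P (p :: 'k \<Rightarrow>\<^sub>0 'c::comm_monoid_add)"
proof -
  have "P (\<Sum>w\<in>S. Poly_Mapping.single w (Poly_Mapping.lookup p w))" if "finite S" for S
    using that
  proof induction
    case empty
    \<comment> \<open>The empty sum is a one-term function with coefficient \<open>0\<close>, at any
      word whatsoever.\<close>
    show ?case using assms(1)[of undefined 0] by simp
  qed (simp add: assms)
  moreover have "p = (\<Sum>w\<in>Poly_Mapping.keys p. Poly_Mapping.single w (Poly_Mapping.lookup p w))"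
    by (rule poly_mapping_eqI)
      (auto simp: lookup_sum lookup_single when_def in_keys_iff sum.delta)
  ultimately show ?thesis
    by (metis finite_keys)
qed

lemma single_Nil_one: "Poly_Mapping.single [] 1 = 1"
  by (metis single_one zero_list_def)

text \<open>Constants are central: the empty word is neutral for concatenation on both sides and
  complex coefficients commute. This makes the free algebra satisfy
  \<open>smult_mult_right\<close>.\<close>

lemma single_Nil_commute:
  "Poly_Mapping.single [] c * p = p * Poly_Mapping.single [] (c :: complex)"
  by (induction p rule: poly_mapping_induct_single)
    (simp_all add: mult_single plus_list_def algebra_simps)

lemma ring_free_algebra: "ring free_algebra"
proof (rule ringI)
  show "abelian_group free_algebra"
    by (rule abelian_groupI) (auto simp: algebra_simps intro: exI[of _ "- _"])
  show "Group.monoid free_algebra"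
    by (rule monoidI) (auto simp: mult.assoc)
qed (auto simp: algebra_simps)

lemma assoc_algebra_free_algebra: "assoc_algebra free_algebra"
proof (rule assoc_algebraI)
  show "ring free_algebra" by (rule ring_free_algebra)
next
  fix c x y
  show "x \<otimes>\<^bsub>free_algebra\<^esub> (c \<odot>\<^bsub>free_algebra\<^esub> y) = c \<odot>\<^bsub>free_algebra\<^esub> (x \<otimes>\<^bsub>free_algebra\<^esub> y)"
    by (simp add: free_algebra_smult single_Nil_commute[of c] mult.assoc)
qed (simp_all add: free_algebra_smult single_Nil_one single_add mult_single plus_list_def
    algebra_simps flip: mult.assoc)

lemma free_algebra_minus: "p \<ominus>\<^bsub>free_algebra\<^esub> q = p - q"
proof -
  interpret ring free_algebra by (rule ring_free_algebra)
  have "\<ominus>\<^bsub>free_algebra\<^esub> q = - q"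
    using minus_equality[of "- q" q] by simp
  then show ?thesis by (simp add: a_minus_def)
qed

section \<open>Evaluation of noncommutative polynomials\<close>

context assoc_algebra
begin

definition word_value :: "('g \<Rightarrow> 'a) \<Rightarrow> 'g list \<Rightarrow> 'a" where
  "word_value x w = foldr (\<lambda>g y. x g \<otimes> y) w \<one>"

definition evaluation :: "('g \<Rightarrow> 'a) \<Rightarrow> ('g list \<Rightarrow>\<^sub>0 complex) \<Rightarrow> 'a" where
  "evaluation x p = (\<Oplus>w\<in>Poly_Mapping.keys p. Poly_Mapping.lookup p w \<odot> word_value x w)"

context
  fixes x :: "'g \<Rightarrow> 'a"
  assumes x: "range x \<subseteq> carrier A"
begin

lemma word_value_closed: "word_value x w \<in> carrier A"
  using x by (induction w) (auto simp: word_value_def)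

lemma word_value_append: "word_value x (v @ w) = word_value x v \<otimes> word_value x w"
proof (induction v)
  case Nil
  show ?case using word_value_closed by (simp add: word_value_def)
next
  case (Cons g v)
  have "x g \<in> carrier A" using x by auto
  with Cons show ?case
    using word_value_closed[of v] word_value_closed[of w] by (simp add: word_value_def A.m_assoc)
qed

lemma term_closed: "c \<odot> word_value x w \<in> carrier A"
  using word_value_closed by simp

text \<open>Words outside the support contribute zero. Cancellation can make the support of
  \<open>p + q\<close> smaller than the union of the supports, so additivity is proved over one
  common index set.\<close>

lemma evaluation_superset:
  assumes "finite S" "Poly_Mapping.keys p \<subseteq> S"
  shows "evaluation x p = (\<Oplus>w\<in>S. Poly_Mapping.lookup p w \<odot> word_value x w)"
  unfolding evaluation_def
  using assms by (intro C.M.add.finprod_mono_neutral_cong_left)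
    (auto simp: term_closed in_keys_iff smult_zero_left word_value_closed)

lemma evaluation_closed: "evaluation x p \<in> carrier A"
  unfolding evaluation_def by (intro C.M.finsum_closed) (auto simp: term_closed)

lemma evaluation_add: "evaluation x (p + q) = evaluation x p \<oplus> evaluation x q"
proof -
  let ?S = "Poly_Mapping.keys p \<union> Poly_Mapping.keys q"
  have "evaluation x (p + q) = (\<Oplus>w\<in>?S. Poly_Mapping.lookup (p + q) w \<odot> word_value x w)"
    using keys_add[of p q] by (intro evaluation_superset) auto
  also have "\<dots> = (\<Oplus>w\<in>?S. Poly_Mapping.lookup p w \<odot> word_value x w \<oplus> Poly_Mapping.lookup q w \<odot> word_value x w)"
    by (simp add: lookup_add C.smult_l_distr[simplified] word_value_closed)
  also have "\<dots> = evaluation x p \<oplus> evaluation x q"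
    by (simp add: C.M.finsum_addf term_closed evaluation_superset[of ?S])
  finally show ?thesis .
qed

lemma evaluation_single: "evaluation x (Poly_Mapping.single w c) = c \<odot> word_value x w"
  using evaluation_superset[of "{w}" "Poly_Mapping.single w c"] by (simp add: term_closed)

text \<open>Both sides are additive in each factor, which leaves one-term polynomials. There
  concatenation of words becomes the product of their values and the scalars move to the
  front.\<close>

lemma evaluation_mult: "evaluation x (p * q) = evaluation x p \<otimes> evaluation x q"
proof (induction p rule: poly_mapping_induct_single)
  case (single v c)
  show ?case
  proof (induction q rule: poly_mapping_induct_single)
    case (single w d)
    show ?case
      by (simp add: mult_single plus_list_def evaluation_single word_value_append word_value_closed
          smult_mult_left smult_mult_right mult.commute[of c] C.smult_assoc1[simplified])
  next
    case (add q r)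
    then show ?case
      by (simp add: distrib_left evaluation_add A.r_distr evaluation_closed)
  qed
next
  case (add p r)
  then show ?case
    by (simp add: distrib_right evaluation_add A.l_distr evaluation_closed)
qed

lemma evaluation_one: "evaluation x 1 = \<one>"
  using evaluation_single[of "[]" 1] by (simp add: word_value_def smult_simps single_Nil_one)

lemma evaluation_algebra_hom: "evaluation x \<in> algebra_hom free_algebra A"
proof -
  have "evaluation x (c \<odot>\<^bsub>free_algebra\<^esub> p) = c \<odot> evaluation x p" for c p
  proof -
    have "evaluation x (c \<odot>\<^bsub>free_algebra\<^esub> p) = (c \<odot> \<one>) \<otimes> evaluation x p"
      by (simp add: free_algebra_smult evaluation_mult evaluation_single word_value_def)
    then show ?thesis
      by (simp add: smult_mult_left evaluation_closed)
  qed
  then show ?thesis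
    by (auto simp: algebra_hom_def evaluation_closed evaluation_mult evaluation_add evaluation_one
        intro!: ring_hom_memI)
qed

lemma evaluation_free_gen: "evaluation x (free_gen g) = x g"
  using x by (auto simp: free_gen_def evaluation_single word_value_def smult_simps image_subset_iff)

end

end

section \<open>The Jordanian algebra\<close>

text \<open>Both sides of every relation are built from the generators by algebra operations, which
  a homomorphism preserves. This is used for the projection onto the quotient and for evaluation at
  given elements.\<close>

lemma jordanian_relations_hom:
  assumes "assoc_algebra A" "assoc_algebra B" "\<phi> \<in> algebra_hom A B" "range x \<subseteq> carrier A"
  shows "jordanian_relations B h k (\<lambda>g. \<phi> (x g)) =
    map (map_prod \<phi> \<phi>) (jordanian_relations A h k x)"
proof -
  interpret A: assoc_algebra A by fact
  interpret B: assoc_algebra B by fact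
  interpret ring_hom_ring A B \<phi>
    using assms(3) by (intro ring_hom_ringI2 A.ring_axioms B.ring_axioms) (simp add: algebra_hom_def)
  have x: "x g \<in> carrier A" for g
    using assms(4) by auto
  have smult: "\<phi> (c \<odot>\<^bsub>A\<^esub> a) = c \<odot>\<^bsub>B\<^esub> \<phi> a" if "a \<in> carrier A" for a c
    using assms(3) that by (simp add: algebra_hom_def)
  have minus: "\<phi> (a \<ominus>\<^bsub>A\<^esub> b) = \<phi> a \<ominus>\<^bsub>B\<^esub> \<phi> b" if "a \<in> carrier A" "b \<in> carrier A" for a b
    using that by (simp add: a_minus_def)
  have pow: "\<phi> (a [^]\<^bsub>A\<^esub> (2::nat)) = \<phi> a [^]\<^bsub>B\<^esub> (2::nat)" if "a \<in> carrier A" for a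
    using that by (simp add: numeral_2_eq_2)
  show ?thesis
    by (simp add: jordanian_relations_def relations_A_def relations_B_def relations_FF_def comm_def
        Let_def x smult minus pow)
qed

context
  fixes h k :: complex
begin

abbreviation relators :: "(generator list \<Rightarrow>\<^sub>0 complex) set" where
  "relators \<equiv> {l - r | l r. (l, r) \<in> set (jordanian_relations free_algebra h k free_gen)}"

lemma ideal_jordanian_ideal: "ideal (jordanian_ideal h k) free_algebra"
  unfolding jordanian_ideal_def
  by (rule ring.genideal_ideal[OF ring_free_algebra]) simp

lemma relator_in_jordanian_ideal:
  assumes "(l, r) \<in> set (jordanian_relations free_algebra h k free_gen)"
  shows "l - r \<in> jordanian_ideal h k"
proof -
  have "relators \<subseteq> jordanian_ideal h k"
    unfolding jordanian_ideal_def by (rule ring.genideal_self[OF ring_free_algebra]) simp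
  with assms show ?thesis by blast
qed

lemma assoc_algebra_jordanian_algebra: "assoc_algebra (jordanian_algebra h k)"
  unfolding jordanian_algebra_def
  by (rule assoc_algebra.assoc_algebra_quotient[OF assoc_algebra_free_algebra ideal_jordanian_ideal])

abbreviation coset :: "(generator list \<Rightarrow>\<^sub>0 complex) \<Rightarrow> (generator list \<Rightarrow>\<^sub>0 complex) set" where
  "coset p \<equiv> jordanian_ideal h k +>\<^bsub>free_algebra\<^esub> p"

lemma coset_hom: "coset \<in> algebra_hom free_algebra (jordanian_algebra h k)"
  unfolding jordanian_algebra_def
  by (rule assoc_algebra.coset_algebra_hom[OF assoc_algebra_free_algebra ideal_jordanian_ideal])

lemma jordanian_carrier: "carrier (jordanian_algebra h k) = range coset"
  unfolding jordanian_algebra_def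
  using assoc_algebra.quotient_carrier[OF assoc_algebra_free_algebra ideal_jordanian_ideal] by simp

lemma coset_operations:
  "coset p \<otimes>\<^bsub>jordanian_algebra h k\<^esub> coset q = coset (p * q)"
  "coset p \<oplus>\<^bsub>jordanian_algebra h k\<^esub> coset q = coset (p + q)"
  "\<one>\<^bsub>jordanian_algebra h k\<^esub> = coset 1"
  "c \<odot>\<^bsub>jordanian_algebra h k\<^esub> coset p = coset (Poly_Mapping.single [] c * p)"
  using coset_hom by (auto simp: algebra_hom_def ring_hom_def free_algebra_smult)

lemma coset_eqI:
  assumes "p - q \<in> jordanian_ideal h k"
  shows "coset p = coset q"
proof -
  interpret ring free_algebra by (rule ring_free_algebra)
  interpret ideal "jordanian_ideal h k" free_algebra by (rule ideal_jordanian_ideal)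
  have "p = (p - q) \<oplus>\<^bsub>free_algebra\<^esub> q" by simp
  with assms have "p \<in> coset q"
    unfolding a_r_coset_def' by blast
  then show ?thesis
    using a_repr_independence[of p "jordanian_ideal h k" q] a_subgroup by simp
qed

text \<open>The coset of a word is a product of generators, and every coset is a linear combination
  of cosets of words.\<close>

lemma jordanian_algebra_generated:
  "generates_algebra (jordanian_algebra h k) (range (jordanian_gen h k))"
  unfolding generates_algebra_def
proof (intro conjI allI impI)
  show "range (jordanian_gen h k) \<subseteq> carrier (jordanian_algebra h k)"
    by (auto simp: jordanian_carrier jordanian_gen_def)
next
  fix B
  assume B: "subring B (jordanian_algebra h k) \<and>
    (\<forall>c. \<forall>b\<in>B. c \<odot>\<^bsub>jordanian_algebra h k\<^esub> b \<in> B) \<and> range (jordanian_gen h k) \<subseteq> B"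
  then have sub: "subring B (jordanian_algebra h k)" by blast
  have word: "coset (Poly_Mapping.single w 1) \<in> B" for w
  proof (induction w)
    case Nil
    show ?case
      using subringE(3)[OF sub] by (simp add: coset_operations single_Nil_one)
  next
    case (Cons g w)
    have "coset (free_gen g) \<in> B"
      using B by (auto simp: jordanian_gen_def)
    with Cons have "coset (free_gen g) \<otimes>\<^bsub>jordanian_algebra h k\<^esub> coset (Poly_Mapping.single w 1) \<in> B"
      using subringE(6)[OF sub] by blast
    then show ?case
      by (simp add: coset_operations free_gen_def mult_single plus_list_def)
  qed
  have "coset p \<in> B" for p
  proof (induction p rule: poly_mapping_induct_single)
    case (single w c)
    have "c \<odot>\<^bsub>jordanian_algebra h k\<^esub> coset (Poly_Mapping.single w 1) \<in> B"
      using B word by blast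
    then show ?case
      by (simp add: coset_operations mult_single plus_list_def)
  next
    case (add p q)
    then have "coset p \<oplus>\<^bsub>jordanian_algebra h k\<^esub> coset q \<in> B"
      using subringE(7)[OF sub] by blast
    then show ?case
      by (simp add: coset_operations)
  qed
  then show "B = carrier (jordanian_algebra h k)"
    using subringE(1)[OF sub] by (auto simp: jordanian_carrier)
qed

text \<open>The relations in the quotient are the images of those between the free generators, whose
  two sides differ by an element of the ideal.\<close>

lemma jordanian_algebra_satisfies:
  "satisfies_jordanian (jordanian_algebra h k) h k (jordanian_gen h k)"
proof -
  have "l = r" if "(l, r) \<in> set (jordanian_relations (jordanian_algebra h k) h k (jordanian_gen h k))"
    for l r
  proof -
    have "jordanian_relations (jordanian_algebra h k) h k (jordanian_gen h k) =
        map (map_prod coset coset) (jordanian_relations free_algebra h k free_gen)"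
      unfolding jordanian_gen_def
      by (rule jordanian_relations_hom[OF assoc_algebra_free_algebra assoc_algebra_jordanian_algebra
            coset_hom]) simp
    with that obtain p q where pq: "(p, q) \<in> set (jordanian_relations free_algebra h k free_gen)"
      "l = coset p" "r = coset q"
      by auto
    then show ?thesis
      using coset_eqI relator_in_jordanian_ideal by blast
  qed
  then show ?thesis
    unfolding satisfies_jordanian_def
    by (auto simp: jordanian_carrier jordanian_gen_def)
qed

text \<open>Evaluation at \<open>x\<close> vanishes on the relators and therefore on the ideal
  generated by them, so it factors through the quotient.\<close>

lemma jordanian_algebra_universal:
  assumes "assoc_algebra A" and sat: "satisfies_jordanian A h k x"
  shows "\<exists>\<phi>\<in>algebra_hom (jordanian_algebra h k) A. \<forall>g. \<phi> (jordanian_gen h k g) = x g"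
proof -
  interpret A: assoc_algebra A by fact
  let ?ev = "A.evaluation x"
  have x: "range x \<subseteq> carrier A"
    using sat by (simp add: satisfies_jordanian_def)
  note ev = A.evaluation_algebra_hom[OF x]
  interpret ev: ring_hom_ring free_algebra A ?ev
    using ev by (intro ring_hom_ringI2 ring_free_algebra A.ring_axioms) (simp add: algebra_hom_def)
  let ?K = "a_kernel free_algebra A ?ev"
  have "jordanian_relations A h k (\<lambda>g. ?ev (free_gen g)) =
      map (map_prod ?ev ?ev) (jordanian_relations free_algebra h k free_gen)"
    by (rule jordanian_relations_hom[OF assoc_algebra_free_algebra assms(1) ev]) simp
  then have relation: "?ev l = ?ev r" if "(l, r) \<in> set (jordanian_relations free_algebra h k free_gen)" for l r
    using sat that unfolding satisfies_jordanian_def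
    by (force simp: A.evaluation_free_gen[OF x])
  have diff: "?ev (p - q) = ?ev p \<ominus>\<^bsub>A\<^esub> ?ev q" for p q
    using ev.hom_add[of p "\<ominus>\<^bsub>free_algebra\<^esub> q"] ev.hom_a_inv[of q]
    by (simp add: free_algebra_minus[symmetric] a_minus_def)
  have "relators \<subseteq> ?K"
  proof clarify
    fix l r assume "(l, r) \<in> set (jordanian_relations free_algebra h k free_gen)"
    then have "?ev (l - r) = \<zero>\<^bsub>A\<^esub>"
      by (simp add: diff relation[of l r] A.evaluation_closed[OF x])
    then show "l - r \<in> ?K"
      by (simp only: a_kernel_def' mem_Collect_eq free_algebra_simps UNIV_I simp_thms)
  qed
  \<comment> \<open>The kernel is an ideal containing the relators, and the generated ideal is the
    smallest such.\<close>
  then have "jordanian_ideal h k \<subseteq> ?K"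
    unfolding jordanian_ideal_def
    by (rule ring.genideal_minimal[OF ring_free_algebra ev.kernel_is_ideal])
  then have kernel: "?ev i = \<zero>\<^bsub>A\<^esub>" if "i \<in> jordanian_ideal h k" for i
    using that by (auto simp only: a_kernel_def' mem_Collect_eq)
  \<comment> \<open>Evaluation is constant on each coset; \<open>the_elem\<close> then reads off the
    common value and serves as the induced map.\<close>
  have "?ev ` coset p = {?ev p}" for p
  proof -
    interpret ideal "jordanian_ideal h k" free_algebra by (rule ideal_jordanian_ideal)
    have "?ev q = ?ev p" if "q \<in> coset p" for q
      using that kernel
      by (auto simp: a_r_coset_def' A.evaluation_add[OF x] A.evaluation_closed[OF x])
    moreover have "p \<in> coset p"
      by (rule a_rcos_self) simp
    ultimately show ?thesis by blast
  qed
  then have \<phi>: "the_elem (?ev ` coset p) = ?ev p" for p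
    by simp
  have "?ev (Poly_Mapping.single [] c * p) = c \<odot>\<^bsub>A\<^esub> ?ev p" for c p
    using ev by (simp add: algebra_hom_def flip: free_algebra_smult)
  then have hom: "(\<lambda>X. the_elem (?ev ` X)) \<in> algebra_hom (jordanian_algebra h k) A"
    by (auto simp: algebra_hom_def jordanian_carrier coset_operations \<phi> A.evaluation_closed[OF x]
        A.evaluation_mult[OF x] A.evaluation_add[OF x] A.evaluation_one[OF x]
        intro!: ring_hom_memI)
  have gen: "the_elem (?ev ` jordanian_gen h k g) = x g" for g
    by (simp add: jordanian_gen_def \<phi> A.evaluation_free_gen[OF x])
  show ?thesis
    by (rule bexI[OF _ hom]) (simp add: gen)
qed

end

section \<open>The endomorphism algebra\<close>

locale complex_vector_space = vector_space scale
  for scale :: "complex \<Rightarrow> 'v::ab_group_add \<Rightarrow> 'v"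
begin

abbreviation End where "End \<equiv> endomorphism_algebra scale"

lemma End_carrier: "f \<in> carrier End \<longleftrightarrow> Vector_Spaces.linear scale scale f"
  by (simp add: endomorphism_algebra_def)

lemma End_carrier_iff:
  "f \<in> carrier End \<longleftrightarrow> (\<forall>x y. f (x + y) = f x + f y) \<and> (\<forall>c x. f (scale c x) = scale c (f x))"
  using vector_space_axioms by (simp add: End_carrier Vector_Spaces.linear_iff)

lemma End_diff: "f \<in> carrier End \<Longrightarrow> f (x - y) = f x - f y"
  using module_hom.diff by (auto simp: End_carrier linear_iff_module_hom)

lemma End_apply:
  "(f \<otimes>\<^bsub>End\<^esub> g) v = f (g v)" "\<one>\<^bsub>End\<^esub> v = v" "(f \<oplus>\<^bsub>End\<^esub> g) v = f v + g v" "\<zero>\<^bsub>End\<^esub> v = 0"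
  "(c \<odot>\<^bsub>End\<^esub> f) v = scale c (f v)"
  by (simp_all add: endomorphism_algebra_def)

lemma ring_End: "ring End"
proof (rule ringI)
  show "abelian_group End"
  proof (rule abelian_groupI)
    fix f assume "f \<in> carrier End"
    then have "(\<lambda>v. - f v) \<in> carrier End \<and> (\<lambda>v. - f v) \<oplus>\<^bsub>End\<^esub> f = \<zero>\<^bsub>End\<^esub>"
      by (auto simp: End_carrier_iff End_apply fun_eq_iff scale_minus_right)
    then show "\<exists>g\<in>carrier End. g \<oplus>\<^bsub>End\<^esub> f = \<zero>\<^bsub>End\<^esub>" by blast
  qed (auto simp: End_carrier_iff End_apply fun_eq_iff scale_right_distrib ac_simps)
  show "Group.monoid End"
    by (rule monoidI) (auto simp: End_carrier_iff End_apply fun_eq_iff)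
qed (auto simp: End_carrier_iff End_apply fun_eq_iff)

lemma End_smult_closed: "f \<in> carrier End \<Longrightarrow> c \<odot>\<^bsub>End\<^esub> f \<in> carrier End"
  by (auto simp: End_carrier_iff End_apply scale_right_distrib mult.commute)

text \<open>The negation of the ring is given only as an additive inverse; evaluating that property
  at \<open>v\<close> identifies it with the pointwise negative.\<close>

lemma End_minus_apply:
  assumes "f \<in> carrier End"
  shows "(\<ominus>\<^bsub>End\<^esub> f) v = - f v"
proof -
  interpret ring End by (rule ring_End)
  have "(\<ominus>\<^bsub>End\<^esub> f \<oplus>\<^bsub>End\<^esub> f) v = \<zero>\<^bsub>End\<^esub> v"
    using assms by (simp add: l_neg)
  then show ?thesis
    by (simp add: End_apply eq_neg_iff_add_eq_0)
qed

lemma End_diff_apply: "g \<in> carrier End \<Longrightarrow> (f \<ominus>\<^bsub>End\<^esub> g) v = f v - g v"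
  by (simp add: a_minus_def End_apply End_minus_apply)

lemma End_comm_apply:
  "f \<in> carrier End \<Longrightarrow> g \<in> carrier End \<Longrightarrow> comm End f g v = f (g v) - g (f v)"
  by (simp add: comm_def End_apply End_diff_apply ring.ring_simprules(5) ring_End)

lemma End_commD:
  "comm End f g = k \<Longrightarrow> f \<in> carrier End \<Longrightarrow> g \<in> carrier End \<Longrightarrow> f (g v) = g (f v) + k v"
  by (auto simp: End_comm_apply)

lemma End_comm_closed:
  "f \<in> carrier End \<Longrightarrow> g \<in> carrier End \<Longrightarrow> comm End f g \<in> carrier End"
  unfolding comm_def by (meson ring.ring_simprules ring_End)

lemma End_square: "f \<in> carrier End \<Longrightarrow> f [^]\<^bsub>End\<^esub> (2::nat) = f \<otimes>\<^bsub>End\<^esub> f"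
  by (simp add: numeral_2_eq_2 monoid.nat_pow_Suc monoid.nat_pow_0 monoid.l_one ring.is_monoid ring_End
      nat_pow_def)

lemmas End_closed = End_smult_closed End_comm_closed ring.ring_simprules(1,2,4,5,6)[OF ring_End]
  monoid.nat_pow_closed[OF ring.is_monoid[OF ring_End]] ring.ring_simprules(3)[OF ring_End]

end

section \<open>Power series in a locally nilpotent operator\<close>

lemma funpow_eq_zero_mono:
  fixes a :: "'v::zero \<Rightarrow> 'v"
  assumes "(a ^^ n) v = 0" "a 0 = 0" "n \<le> m"
  shows "(a ^^ m) v = 0"
proof -
  have "(a ^^ k) 0 = 0" for k
    using assms(2) by (induction k) simp_all
  moreover obtain k where "m = k + n"
    using assms(3) by (metis add.commute le_Suc_ex)
  ultimately show ?thesis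
    using assms(1) by (simp add: funpow_add)
qed

locale nilpotent_operator = complex_vector_space scale
  for scale :: "complex \<Rightarrow> 'v::ab_group_add \<Rightarrow> 'v" (infixr \<open>*s\<close> 75) +
  fixes a :: "'v \<Rightarrow> 'v"
  assumes linear_a: "Vector_Spaces.linear scale scale a"
    and locally_nilpotent_a: "locally_nilpotent a"
begin

abbreviation psi :: "complex fps \<Rightarrow> 'v \<Rightarrow> 'v" where
  "psi \<equiv> series_at scale a"

lemma linear_funpow: "Vector_Spaces.linear scale scale (a ^^ k)"
proof (induction k)
  case 0
  then show ?case by (simp add: linear_ident)
next
  case (Suc k)
  then show ?case using Vector_Spaces.linear_compose[OF Suc linear_a] by (simp only: funpow.simps)
qed

lemma funpow_add_right: "(a ^^ k) (u + v) = (a ^^ k) u + (a ^^ k) v"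
  and funpow_scale: "(a ^^ k) (c *s v) = c *s (a ^^ k) v"
  using linear_funpow[of k] by (simp_all add: Vector_Spaces.linear_iff)

lemma a_zero: "a 0 = 0"
  using linear_a unfolding Vector_Spaces.linear_iff by (metis scale_zero_left)

lemma funpow_sum: "(a ^^ k) (sum f I) = (\<Sum>i\<in>I. (a ^^ k) (f i))"
proof -
  interpret module_hom scale scale "a ^^ k"
    using linear_funpow by (simp add: linear_iff_module_hom)
  show ?thesis by (rule sum)
qed

lemma nilpotency_bound:
  obtains n where "(a ^^ n) v = 0"
  using locally_nilpotent_a unfolding locally_nilpotent_def by blast

text \<open>Local nilpotency gives a separate bound for each vector. The maximum over finitely many
  vectors lets the series at all of them be truncated at the same place.\<close>

lemma common_nilpotency_bound:
  assumes "finite S"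
  obtains n where "\<forall>v\<in>S. (a ^^ n) v = 0"
proof -
  from assms have "\<exists>n. \<forall>v\<in>S. (a ^^ n) v = 0"
  proof induction
    case (insert v S)
    then obtain n m where "\<forall>v\<in>S. (a ^^ n) v = 0" "(a ^^ m) v = 0"
      using nilpotency_bound by metis
    then have "\<forall>v\<in>insert v S. (a ^^ max n m) v = 0"
      using funpow_eq_zero_mono a_zero by (metis insert_iff max.cobounded1 max.cobounded2)
    then show ?case ..
  qed simp
  with that show ?thesis by blast
qed

text \<open>Replaces the index set of \<open>series_at\<close>, which depends on \<open>v\<close>,
  by an initial segment of any sufficient length.\<close>

lemma psi_eq_sum:
  assumes "(a ^^ n) v = 0"
  shows "psi A v = (\<Sum>k<n. (fps_nth A k) *s (a ^^ k) v)"
proof -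
  have "{k. (a ^^ k) v \<noteq> 0} \<subseteq> {..<n}"
    using funpow_eq_zero_mono[OF assms a_zero] by (force simp flip: not_le)
  then show ?thesis
    unfolding series_at_def by (intro sum.mono_neutral_left) auto
qed

lemma psi_add: "psi (A + B) v = psi A v + psi B v"
proof -
  obtain n where "(a ^^ n) v = 0" by (rule nilpotency_bound)
  then show ?thesis by (simp add: psi_eq_sum scale_left_distrib sum.distrib)
qed

lemma psi_const: "psi (fps_const c) v = c *s v"
proof -
  obtain n where "(a ^^ n) v = 0" by (rule nilpotency_bound)
  \<comment> \<open>The larger bound keeps the index \<open>0\<close> in the range of summation even
    if \<open>n\<close> is \<open>0\<close>.\<close>
  then have "(a ^^ Suc n) v = 0" by (simp add: a_zero)
  from psi_eq_sum[OF this] show ?thesis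
    by (simp add: if_distrib[of "\<lambda>x. scale x _"] sum.delta' cong: if_cong)
qed

lemma psi_X: "psi fps_X v = a v"
proof -
  obtain n where "(a ^^ n) v = 0" by (rule nilpotency_bound)
  \<comment> \<open>Two more than \<open>n\<close>, so that the index \<open>1\<close> is certainly
    in the range of summation.\<close>
  then have "(a ^^ Suc (Suc n)) v = 0" by (simp add: a_zero)
  from psi_eq_sum[OF this] show ?thesis
    by (simp add: fps_X_def if_distrib[of "\<lambda>x. scale x _"] sum.delta' cong: if_cong)
qed

lemma linear_psi: "Vector_Spaces.linear scale scale (psi A)"
proof -
  have "psi A (x + y) = psi A x + psi A y" for x y
  proof -
    obtain n where "\<forall>v\<in>{x, y, x + y}. (a ^^ n) v = 0"
      by (rule common_nilpotency_bound[of "{x, y, x + y}"]) auto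
    then have n: "(a ^^ n) x = 0" "(a ^^ n) y = 0" "(a ^^ n) (x + y) = 0" by blast+
    show ?thesis
      unfolding n[THEN psi_eq_sum] by (simp add: funpow_add_right scale_right_distrib sum.distrib)
  qed
  moreover have "psi A (c *s x) = c *s psi A x" for c x
  proof -
    obtain n where "\<forall>v\<in>{x, c *s x}. (a ^^ n) v = 0"
      by (rule common_nilpotency_bound[of "{x, c *s x}"]) auto
    then have n: "(a ^^ n) x = 0" "(a ^^ n) (c *s x) = 0" by blast+
    show ?thesis
      unfolding n[THEN psi_eq_sum] by (simp add: funpow_scale scale_sum_right mult.commute)
  qed
  ultimately show ?thesis
    using vector_space_axioms by (simp add: Vector_Spaces.linear_iff)
qed

text \<open>The composite is a finite double sum over a square. Its terms with
  \<open>n \<le> i + j\<close> vanish, and summing the remaining triangle along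
  \<open>i + j = k\<close> gives the Cauchy product.\<close>

lemma psi_mult: "psi (A * B) v = psi A (psi B v)"
proof -
  let ?g = "\<lambda>i j. (fps_nth A i * fps_nth B j) *s (a ^^ (i + j)) v"
  obtain n where "\<forall>w\<in>{v, psi B v}. (a ^^ n) w = 0"
    by (rule common_nilpotency_bound[of "{v, psi B v}"]) auto
  then have n: "(a ^^ n) v = 0" "(a ^^ n) (psi B v) = 0" by auto
  have zero: "?g i j = 0" if "n \<le> i + j" for i j
    using funpow_eq_zero_mono[OF n(1) a_zero that] by simp
  have "psi A (psi B v) = (\<Sum>i<n. \<Sum>j<n. ?g i j)"
    by (subst psi_eq_sum[OF n(2)]) (simp add: psi_eq_sum[OF n(1), of B] funpow_sum funpow_scale scale_sum_right funpow_add)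
  also have "\<dots> = (\<Sum>(i,j)\<in>{..<n} \<times> {..<n}. ?g i j)"
    by (simp add: sum.cartesian_product)
  also have "\<dots> = (\<Sum>(i,j)\<in>{(i,j). i + j < n}. ?g i j)"
  proof (rule sum.mono_neutral_right, goal_cases)
    case 3
    show ?case
      using zero by (simp del: scale_eq_0_iff add: not_less case_prod_beta)
  qed auto
  also have "\<dots> = (\<Sum>k<n. \<Sum>i\<le>k. ?g i (k - i))"
    by (rule sum.triangle_reindex)
  also have "\<dots> = psi (A * B) v"
    by (auto simp: psi_eq_sum[OF n(1)] fps_mult_nth atLeast0AtMost scale_sum_left intro!: sum.cong)
  finally show ?thesis by simp
qed

text \<open>If \<open>[x, a] = y\<close> commutes with \<open>a\<close>, then
  \<open>[x, a^k] = k a^(k-1) y\<close>; summing this over the terms of the series produces the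
  formal derivative.\<close>

lemma psi_derivation:
  assumes x: "x \<in> carrier End" and y: "y \<in> carrier End"
    and xa: "\<And>v. x (a v) = a (x v) + y v" and ya: "\<And>v. y (a v) = a (y v)"
  shows "x (psi A v) = psi A (x v) + psi (fps_deriv A) (y v)"
proof -
  interpret x: module_hom scale scale x
    using x by (simp add: End_carrier linear_iff_module_hom)
  have y_funpow: "y ((a ^^ k) v) = (a ^^ k) (y v)" for k
    by (induction k) (simp_all add: ya)
  \<comment> \<open>For \<open>k = 0\<close> the truncated exponent \<open>k - 1\<close> is
    harmless, since its coefficient is zero.\<close>
  have x_funpow: "x ((a ^^ k) v) = (a ^^ k) (x v) + of_nat k *s (a ^^ (k - 1)) (y v)" for k
  proof (induction k)
    case (Suc k)
    have a: "a (u + w) = a u + a w" "a (c *s u) = c *s a u" for u w c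
      using funpow_add_right[of 1] funpow_scale[of 1] by simp_all
    have "of_nat k *s a ((a ^^ (k - 1)) (y v)) = of_nat k *s (a ^^ k) (y v)"
      by (cases k) simp_all
    with Suc show ?case
      by (simp add: xa a y_funpow algebra_simps)
  qed simp
  obtain n where "\<forall>w\<in>{v, x v, y v}. (a ^^ n) w = 0"
    by (rule common_nilpotency_bound[of "{v, x v, y v}"]) auto
  \<comment> \<open>Differentiation lowers the index by one, so the series at \<open>y v\<close> is
    cut one place earlier than the other two.\<close>
  then have n: "(a ^^ Suc n) v = 0" "(a ^^ Suc n) (x v) = 0" "(a ^^ n) (y v) = 0"
    by (auto simp: a_zero)
  have "x (psi A v) = psi A (x v) + (\<Sum>k<Suc n. (of_nat k * fps_nth A k) *s (a ^^ (k - 1)) (y v))"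
    by (simp add: psi_eq_sum[OF n(1)] psi_eq_sum[OF n(2)] x.sum x.scale x_funpow x.add
        scale_right_distrib sum.distrib mult.commute del: sum.lessThan_Suc)
  \<comment> \<open>The term for \<open>k = 0\<close> is zero, and shifting the index by one yields
    the coefficients of the derivative.\<close>
  also have "(\<Sum>k<Suc n. (of_nat k * fps_nth A k) *s (a ^^ (k - 1)) (y v)) = psi (fps_deriv A) (y v)"
    by (simp add: psi_eq_sum[OF n(3)] sum.lessThan_Suc_shift del: sum.lessThan_Suc)
  finally show ?thesis .
qed

end

section \<open>The power series of the nonlinear map\<close>

text \<open>The reciprocal of the square root \<open>s\<close>. It is adjoined because
  \<open>s' = h^2 X / s\<close>: with it the derivatives of all the series remain polynomials in the
  series.\<close>

definition series_R :: "complex \<Rightarrow> complex fps" where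
  "series_R h = inverse (sqrt_series h)"

text \<open>Exponents of binomial series add under multiplication, and composition respects
  products. The constants are expressed by \<open>h/2\<close>, the only parameter depending on
  \<open>h\<close> in the polynomial identities below.\<close>

lemma sqrt_series_square:
  "sqrt_series h * sqrt_series h = 1 + 4 * fps_const (h/2) * fps_const (h/2) * fps_X * fps_X"
proof -
  have "sqrt_series h * sqrt_series h = fps_compose (1 + fps_X) (fps_const (h^2) * fps_X^2)"
    unfolding sqrt_series_def
    by (simp flip: fps_compose_mult_distrib fps_binomial_add_mult add: fps_binomial_1)
  also have "\<dots> = 1 + fps_const (h^2) * fps_X^2"
    by (simp add: fps_compose_add_distrib)
  finally show ?thesis
    by (simp add: power2_eq_square numeral_fps_const mult.assoc)
qed

lemma sqrt_series_inverse: "sqrt_series h * series_R h = 1"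
  unfolding series_R_def by (intro inverse_mult_eq_1') (simp add: sqrt_series_def)

lemma T_series_eq: "T_series h = 2 * fps_const (h/2) * fps_X + sqrt_series h"
  by (simp add: T_series_def numeral_fps_const)

lemma Tinv_series_eq: "Tinv_series h = - 2 * fps_const (h/2) * fps_X + sqrt_series h"
  by (simp add: Tinv_series_def numeral_fps_const)

text \<open>\<open>T_series h - 1\<close> has no constant term, so it may be substituted into
  binomial series; the exponents add up to \<open>1\<close> and to \<open>0\<close>.\<close>

lemma T_half_series_square: "T_half_series h * T_half_series h = T_series h"
  and T_half_series_inverse: "T_half_series h * Tinv_half_series h = 1"
proof -
  have [simp]: "fps_nth (T_series h) 0 = 1"
    by (simp add: T_series_def sqrt_series_def)
  have "T_half_series h * T_half_series h = fps_compose (1 + fps_X) (T_series h - 1)"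
    unfolding T_half_series_def
    by (simp flip: fps_compose_mult_distrib fps_binomial_add_mult add: fps_binomial_1)
  then show "T_half_series h * T_half_series h = T_series h"
    by (simp add: fps_compose_add_distrib)
  show "T_half_series h * Tinv_half_series h = 1"
    unfolding T_half_series_def Tinv_half_series_def
    by (simp flip: fps_compose_mult_distrib fps_binomial_add_mult)
qed

text \<open>Power series do not form a field, so \<open>fps_const (1/4)\<close> enters polynomial
  arguments as an indeterminate subject to this equation.\<close>

lemma quarter: "4 * fps_const (1/4) = (1 :: complex fps)"
  by (simp add: numeral_fps_const)

text \<open>The polynomial identities from which equality of coefficients is deduced. In particular
  \<open>T_series h\<close> and \<open>Tinv_series h\<close> are mutually inverse, their product
  being \<open>s^2 - h^2 X^2 = 1\<close>.\<close>

lemmas series_relations = sqrt_series_square sqrt_series_inverse T_series_eq Tinv_series_eq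
  T_half_series_square T_half_series_inverse

lemma fps_deriv_numeral: "fps_deriv (numeral n) = 0"
  by (simp add: numeral_fps_const)

text \<open>Each formula comes from differentiating an algebraic relation of the series and solving
  for the derivative; the factors to be divided out are invertible by the same relations.\<close>

lemma fps_deriv_series:
  "fps_deriv (sqrt_series h) = 4 * fps_const (h/2) * fps_const (h/2) * fps_X * series_R h"
  "fps_deriv (series_R h) =
    - 4 * fps_const (h/2) * fps_const (h/2) * fps_X * series_R h * series_R h * series_R h"
  "fps_deriv (T_series h) = 2 * fps_const (h/2) * T_series h * series_R h"
  "fps_deriv (Tinv_series h) = - 2 * fps_const (h/2) * Tinv_series h * series_R h"
  "fps_deriv (T_half_series h) = fps_const (h/2) * T_half_series h * series_R h"
  "fps_deriv (Tinv_half_series h) = - fps_const (h/2) * Tinv_half_series h * series_R h"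
proof -
  note deriv_simps = fps_deriv_mult fps_deriv_add fps_deriv_fps_X fps_deriv_numeral fps_deriv_const
    fps_deriv_1 fps_deriv_neg
  \<comment> \<open>The differentiated relations are linear in the unknown derivatives.\<close>
  note s = arg_cong[OF sqrt_series_square[of h], of fps_deriv, unfolded deriv_simps]
  note r = arg_cong[OF sqrt_series_inverse[of h], of fps_deriv, unfolded deriv_simps]
  note U = arg_cong[OF T_half_series_square[of h], of fps_deriv, unfolded deriv_simps]
  note W = arg_cong[OF T_half_series_inverse[of h], of fps_deriv, unfolded deriv_simps]
  note eqs = sqrt_series_square[of h] sqrt_series_inverse[of h] T_series_eq[of h]
    Tinv_series_eq[of h] T_half_series_square[of h] T_half_series_inverse[of h] quarter
  show s': "fps_deriv (sqrt_series h) = 4 * fps_const (h/2) * fps_const (h/2) * fps_X * series_R h"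
    using eqs s by Groebner_Basis.algebra
  show "fps_deriv (series_R h) =
    - 4 * fps_const (h/2) * fps_const (h/2) * fps_X * series_R h * series_R h * series_R h"
    using eqs s' r by Groebner_Basis.algebra
  have "fps_deriv (T_series h) = 2 * fps_const (h/2) + fps_deriv (sqrt_series h)"
    by (simp add: T_series_eq fps_deriv_numeral)
  then show T': "fps_deriv (T_series h) = 2 * fps_const (h/2) * T_series h * series_R h"
    using eqs s' by Groebner_Basis.algebra
  have "fps_deriv (Tinv_series h) = - 2 * fps_const (h/2) + fps_deriv (sqrt_series h)"
    by (simp add: Tinv_series_eq fps_deriv_numeral)
  then show "fps_deriv (Tinv_series h) = - 2 * fps_const (h/2) * Tinv_series h * series_R h"
    using eqs s' by Groebner_Basis.algebra
  show U': "fps_deriv (T_half_series h) = fps_const (h/2) * T_half_series h * series_R h"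
    using eqs T' U by Groebner_Basis.algebra
  show "fps_deriv (Tinv_half_series h) = - fps_const (h/2) * Tinv_half_series h * series_R h"
    using eqs U' W by Groebner_Basis.algebra
qed

section \<open>Normal forms\<close>

lemma chevalley_carrier:
  assumes "chevalley_sl3 A h1 h2 e1 e2 f1 f2"
  shows "{h1, h2, e1, e2, f1, f2} \<subseteq> carrier A"
  by (insert assms, unfold chevalley_sl3_def) (elim conjE, assumption)

lemma chevalleyD:
  assumes "chevalley_sl3 A h1 h2 e1 e2 f1 f2"
  shows "comm A h1 h2 = \<zero>\<^bsub>A\<^esub>"
     "comm A h1 e1 = 2 \<odot>\<^bsub>A\<^esub> e1" "comm A h1 e2 = \<ominus>\<^bsub>A\<^esub> e2"
     "comm A h2 e1 = \<ominus>\<^bsub>A\<^esub> e1" "comm A h2 e2 = 2 \<odot>\<^bsub>A\<^esub> e2"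
     "comm A h1 f1 = (-2) \<odot>\<^bsub>A\<^esub> f1" "comm A h1 f2 = f2"
     "comm A h2 f1 = f1" "comm A h2 f2 = (-2) \<odot>\<^bsub>A\<^esub> f2"
     "comm A e1 f1 = h1" "comm A e1 f2 = \<zero>\<^bsub>A\<^esub>"
     "comm A e2 f1 = \<zero>\<^bsub>A\<^esub>" "comm A e2 f2 = h2"
     "comm A e1 (comm A e1 e2) = \<zero>\<^bsub>A\<^esub>" "comm A e2 (comm A e2 e1) = \<zero>\<^bsub>A\<^esub>"
     "comm A f1 (comm A f1 f2) = \<zero>\<^bsub>A\<^esub>" "comm A f2 (comm A f2 f1) = \<zero>\<^bsub>A\<^esub>"
  by (insert assms, unfold chevalley_sl3_def) (elim conjE, assumption)+

section \<open>Modules over sl(3) on which \<open>e3\<close> is locally nilpotent\<close>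

locale sl3_module = nilpotent_operator scale e3
  for scale :: "complex \<Rightarrow> 'v::ab_group_add \<Rightarrow> 'v" (infixr \<open>*s\<close> 75) and e3 +
  fixes h1 h2 e1 e2 f1 f2 :: "'v \<Rightarrow> 'v"
  assumes chevalley: "chevalley_sl3 (endomorphism_algebra scale) h1 h2 e1 e2 f1 f2"
    and e3_eq: "e3 = comm (endomorphism_algebra scale) e1 e2"
begin

lemma generator_closed: "h1 \<in> carrier End" "h2 \<in> carrier End" "e1 \<in> carrier End" "e2 \<in> carrier End"
  "f1 \<in> carrier End" "f2 \<in> carrier End"
  using chevalley_carrier[OF chevalley] by simp_all

lemma psi_closed: "psi A \<in> carrier End"
  using linear_psi by (simp add: End_carrier)

definition h3 :: "'v \<Rightarrow> 'v" where "h3 v = h1 v + h2 v"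
definition f3 :: "'v \<Rightarrow> 'v" where "f3 v = f2 (f1 v) - f1 (f2 v)"

lemma h3_f3_closed: "h3 \<in> carrier End" "f3 \<in> carrier End"
proof -
  have "h3 = h1 \<oplus>\<^bsub>End\<^esub> h2" "f3 = comm End f2 f1"
    using generator_closed by (simp_all add: fun_eq_iff h3_def f3_def End_apply End_comm_apply)
  then show "h3 \<in> carrier End" "f3 \<in> carrier End"
    using generator_closed by (simp_all add: End_closed)
qed

lemma operator_add:
  "h1 (x + y) = h1 x + h1 y" "h3 (x + y) = h3 x + h3 y" "e1 (x + y) = e1 x + e1 y"
  "e2 (x + y) = e2 x + e2 y" "f1 (x + y) = f1 x + f1 y" "f2 (x + y) = f2 x + f2 y"
  "f3 (x + y) = f3 x + f3 y" "psi A (x + y) = psi A x + psi A y"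
  using generator_closed h3_f3_closed psi_closed by (simp_all add: End_carrier_iff)

lemma operator_scale:
  "h1 (c *s x) = c *s h1 x" "h2 (c *s x) = c *s h2 x" "e1 (c *s x) = c *s e1 x"
  "e2 (c *s x) = c *s e2 x" "f1 (c *s x) = c *s f1 x" "f2 (c *s x) = c *s f2 x"
  using generator_closed by (simp_all add: End_carrier_iff)

lemma operator_diff:
  "h1 (x - y) = h1 x - h1 y" "h2 (x - y) = h2 x - h2 y" "e1 (x - y) = e1 x - e1 y"
  "e2 (x - y) = e2 x - e2 y" "f1 (x - y) = f1 x - f1 y" "f2 (x - y) = f2 x - f2 y"
  using generator_closed by (simp_all add: End_diff)

lemma operator_zero: "psi A 0 = 0"
  by (metis operator_add(8) add_cancel_right_right)

lemma e3_apply: "e3 v = e1 (e2 v) - e2 (e1 v)"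
  using generator_closed by (simp add: e3_eq End_comm_apply)

text \<open>The Chevalley relations as exchange rules that move \<open>e1, e2\<close> to the left of
  \<open>h1, h2\<close>, and these to the left of \<open>f1, f2\<close>. The last two lines are the
  Serre relations, read as commutation with \<open>e3\<close> and \<open>f3\<close>.\<close>

lemma commutation:
  "h1 (h2 v) = h2 (h1 v)"
  "h1 (e1 v) = e1 (h1 v) + scale 2 (e1 v)" "h1 (e2 v) = e2 (h1 v) - e2 v"
  "h2 (e1 v) = e1 (h2 v) - e1 v" "h2 (e2 v) = e2 (h2 v) + scale 2 (e2 v)"
  "f1 (h1 v) = h1 (f1 v) + scale 2 (f1 v)" "f2 (h1 v) = h1 (f2 v) - f2 v"
  "f1 (h2 v) = h2 (f1 v) - f1 v" "f2 (h2 v) = h2 (f2 v) + scale 2 (f2 v)"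
  "f1 (e1 v) = e1 (f1 v) - h1 v" "f2 (e1 v) = e1 (f2 v)"
  "f1 (e2 v) = e2 (f1 v)" "f2 (e2 v) = e2 (f2 v) - h2 v"
  "e1 (e3 v) = e3 (e1 v)" "e2 (e3 v) = e3 (e2 v)"
  "f3 (f1 v) = f1 (f3 v)" "f3 (f2 v) = f2 (f3 v)"
proof -
  note closed = generator_closed End_comm_closed
  note apply_rules = End_apply End_minus_apply End_comm_apply closed
  note c = chevalleyD[OF chevalley]
  note D = c[THEN End_commD, simplified apply_rules add_0_right scale_minus_left]
  show "h1 (h2 v) = h2 (h1 v)"
    "h1 (e1 v) = e1 (h1 v) + scale 2 (e1 v)" "h1 (e2 v) = e2 (h1 v) - e2 v"
    "h2 (e1 v) = e1 (h2 v) - e1 v" "h2 (e2 v) = e2 (h2 v) + scale 2 (e2 v)"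
    using D(1-5)[of v] closed by simp_all
  show "f1 (h1 v) = h1 (f1 v) + scale 2 (f1 v)" "f2 (h1 v) = h1 (f2 v) - f2 v"
    "f1 (h2 v) = h2 (f1 v) - f1 v" "f2 (h2 v) = h2 (f2 v) + scale 2 (f2 v)"
    using D(6-9)[of v] by simp_all
  show "f1 (e1 v) = e1 (f1 v) - h1 v" "f2 (e1 v) = e1 (f2 v)"
    "f1 (e2 v) = e2 (f1 v)" "f2 (e2 v) = e2 (f2 v) - h2 v"
    using D(10-13)[of v] by simp_all
  show "e1 (e3 v) = e3 (e1 v)" "e2 (e3 v) = e3 (e2 v)"
    using D(14,15)[of v] by (simp_all add: e3_apply operator_diff algebra_simps)
  show "f3 (f1 v) = f1 (f3 v)" "f3 (f2 v) = f2 (f3 v)"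
    using D(16,17)[of v] by (simp_all add: f3_def operator_diff algebra_simps)
qed

section \<open>Moving the generators past power series in \<open>e3\<close>\<close>

lemma scale_two: "scale 2 v = v + v"
  using scale_left_distrib[of 1 1 v] by simp

lemma psi_one: "psi 1 v = v"
  using psi_const[of 1 v] by simp

lemma psi_minus: "psi (- A) v = - psi A v"
  using psi_add[of A "- A" v] psi_const[of 0 v] by (simp add: eq_neg_iff_add_eq_0 add.commute)

lemma psi_numeral: "psi (numeral n) v = scale (numeral n) v"
  using psi_const[of "numeral n" v] by (simp add: numeral_fps_const)

lemma psi_diff_arg: "psi A (u - v) = psi A u - psi A v" and psi_minus_arg: "psi A (- v) = - psi A v"
  using psi_closed[of A] End_diff[of "psi A" u v] End_diff[of "psi A" 0 v] operator_zero by simp_all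

text \<open>By the Serre relations \<open>e1\<close> and \<open>e2\<close> commute with
  \<open>e3\<close>, so \<open>psi_derivation\<close> applies with \<open>y = 0\<close>.\<close>

lemma e1_psi: "e1 (psi A v) = psi A (e1 v)" and e2_psi: "e2 (psi A v) = psi A (e2 v)"
proof -
  have "(\<lambda>v. 0) \<in> carrier End"
    by (simp add: End_carrier_iff)
  then show "e1 (psi A v) = psi A (e1 v)" "e2 (psi A v) = psi A (e2 v)"
    using psi_derivation[of e1 "\<lambda>v. 0" A v] psi_derivation[of e2 "\<lambda>v. 0" A v]
      generator_closed commutation a_zero by (simp_all add: operator_zero)
qed

text \<open>The root vector \<open>e3\<close> has weight \<open>1\<close> for both \<open>h1\<close>
  and \<open>h2\<close>, so both act on series as the Euler derivation.\<close>

lemma h1_psi: "h1 (psi A v) = psi A (h1 v) + psi (fps_X * fps_deriv A) v"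
  and h2_psi: "h2 (psi A v) = psi A (h2 v) + psi (fps_X * fps_deriv A) v"
proof -
  have "e3 \<in> carrier End"
    using generator_closed by (simp add: e3_eq End_comm_closed)
  moreover have "h1 (e3 v) = e3 (h1 v) + e3 v" "h2 (e3 v) = e3 (h2 v) + e3 v" for v
    by (simp_all add: e3_apply operator_diff operator_add operator_scale commutation scale_two
        algebra_simps)
  ultimately show "h1 (psi A v) = psi A (h1 v) + psi (fps_X * fps_deriv A) v"
    "h2 (psi A v) = psi A (h2 v) + psi (fps_X * fps_deriv A) v"
    using psi_derivation[of h1 e3 A v] psi_derivation[of h2 e3 A v] generator_closed
    by (simp_all add: psi_mult psi_X mult.commute[of fps_X])
qed

lemma h3_psi: "h3 (psi A v) = psi A (h3 v) + psi (2 * fps_X * fps_deriv A) v"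
proof -
  have "2 * fps_X * fps_deriv A = fps_X * fps_deriv A + fps_X * fps_deriv A"
    by (simp only: mult_2 distrib_right)
  then show ?thesis
    unfolding h3_def h1_psi h2_psi by (simp only: psi_add operator_add add.assoc add.left_commute)
qed

text \<open>Here \<open>[f1, e3] = e2\<close>, which commutes with \<open>e3\<close> as
  \<open>psi_derivation\<close> demands.\<close>

lemma f1_psi: "f1 (psi A v) = psi A (f1 v) + psi (fps_deriv A) (e2 v)"
proof -
  have "f1 (e3 v) = e3 (f1 v) + e2 v" for v
    by (simp add: e3_apply operator_diff commutation)
  then show ?thesis
    using psi_derivation[of f1 e2 A v] generator_closed commutation by simp
qed

text \<open>As for \<open>f1\<close>, now with \<open>[f2, e3] = -e1\<close>.\<close>

lemma f2_psi: "f2 (psi A v) = psi A (f2 v) + psi (- fps_deriv A) (e1 v)"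
proof -
  have "(\<lambda>v. - e1 v) \<in> carrier End"
    using generator_closed(3) by (simp add: End_carrier_iff)
  moreover have "f2 (e3 v) = e3 (f2 v) + - e1 v" for v
    by (simp add: e3_apply operator_diff commutation)
  moreover have "- e1 (e3 v) = e3 (- e1 v)" for v
    using psi_minus_arg[of fps_X "e1 v"] by (simp add: psi_X commutation)
  ultimately show ?thesis
    using psi_derivation[of f2 "\<lambda>v. - e1 v" A v] generator_closed
    by (simp add: psi_minus_arg psi_minus)
qed

text \<open>The commutator \<open>[f3, e3] = -h3\<close> does not commute with \<open>e3\<close>, so
  \<open>psi_derivation\<close> is out of reach. Instead the rules for \<open>f1\<close> and
  \<open>f2\<close> are composed; the second derivatives appear with
  \<open>e1 e2 - e2 e1 = e3\<close>, whence the factor \<open>fps_X\<close>.\<close>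

lemma f3_psi: "f3 (psi A v) = psi A (f3 v) + psi (- fps_deriv A) (h3 v)
    + psi (- (fps_X * fps_deriv (fps_deriv A))) v"
proof -
  have "psi (fps_X * fps_deriv (fps_deriv A)) v
      = psi (fps_deriv (fps_deriv A)) (e1 (e2 v)) - psi (fps_deriv (fps_deriv A)) (e2 (e1 v))"
    by (simp add: mult.commute[of fps_X] psi_mult psi_X e3_apply psi_diff_arg)
  then show ?thesis
    by (simp add: f3_def h3_def f1_psi f2_psi operator_add operator_diff psi_minus psi_diff_arg
        commutation algebra_simps)
qed

lemma e2_e1: "e2 (e1 v) = e1 (e2 v) + psi (- fps_X) v"
  by (simp add: psi_minus psi_X e3_apply)

lemma f3_commutation:
  "f3 (e1 v) = e1 (f3 v) + f2 v" "f3 (e2 v) = e2 (f3 v) + psi (-1) (f1 v)"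
  "f3 (h1 v) = h1 (f3 v) + f3 v" "f3 (h3 v) = h3 (f3 v) + psi 2 (f3 v)"
  by (simp_all add: f3_def h3_def commutation operator_diff operator_add operator_scale psi_minus
      psi_one psi_numeral scale_two algebra_simps)

lemma h3_commutation:
  "h3 (e1 v) = e1 (h3 v) + e1 v" "h3 (e2 v) = e2 (h3 v) + e2 v" "h3 (h1 v) = h1 (h3 v)"
  "f1 (h3 v) = h3 (f1 v) + f1 v" "f2 (h3 v) = h3 (f2 v) + f2 v"
  by (simp_all add: h3_def commutation operator_diff operator_add operator_scale scale_two algebra_simps)

text \<open>The normal form is a sum of terms \<open>psi A (w x)\<close> with an ordered word \<open>w\<close> in
  \<open>e1, e2, h1, h3, f1, f2, f3\<close>. No relation has more than nine summands between two
  that \<open>collect\<close> has to merge. The summand \<open>0\<close> in \<open>eq_by_normal_form\<close> ends the sum,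
  so that every other summand has a right neighbour.\<close>

lemma normal_form:
  "x - y = x + psi (-1) y" "- x = psi (-1) x" "x + y + z = x + (y + z)" "0 + x = x"
  "scale c x = psi (fps_const c) x"
  "psi A 0 = 0"
  "psi A (psi B x) = psi (A * B) x"
  "psi A (x + y) = psi A x + psi A y"
  "e1 (x + y) = e1 x + e1 y" "e2 (x + y) = e2 x + e2 y"
  "h1 (x + y) = h1 x + h1 y" "h3 (x + y) = h3 x + h3 y"
  "f1 (x + y) = f1 x + f1 y" "f2 (x + y) = f2 x + f2 y" "f3 (x + y) = f3 x + f3 y"
  "e1 (psi A x) = psi A (e1 x)" "e2 (psi A x) = psi A (e2 x)"
  "h1 (psi A x) = psi A (h1 x) + psi (fps_X * fps_deriv A) x"
  "h3 (psi A x) = psi A (h3 x) + psi (2 * fps_X * fps_deriv A) x"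
  "f1 (psi A x) = psi A (f1 x) + psi (fps_deriv A) (e2 x)"
  "f2 (psi A x) = psi A (f2 x) + psi (- fps_deriv A) (e1 x)"
  "f3 (psi A x) = psi A (f3 x) + psi (- fps_deriv A) (h3 x)
    + psi (- (fps_X * fps_deriv (fps_deriv A))) x"
  "h2 x = h3 x + psi (-1) (h1 x)"
  "e2 (e1 x) = e1 (e2 x) + psi (- fps_X) x"
  "h1 (e1 x) = e1 (h1 x) + psi 2 (e1 x)" "h1 (e2 x) = e2 (h1 x) + psi (-1) (e2 x)"
  "h3 (e1 x) = e1 (h3 x) + e1 x" "h3 (e2 x) = e2 (h3 x) + e2 x" "h3 (h1 x) = h1 (h3 x)"
  "f1 (e1 x) = e1 (f1 x) + psi (-1) (h1 x)" "f1 (e2 x) = e2 (f1 x)"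
  "f1 (h1 x) = h1 (f1 x) + psi 2 (f1 x)" "f1 (h3 x) = h3 (f1 x) + f1 x"
  "f2 (e1 x) = e1 (f2 x)" "f2 (e2 x) = e2 (f2 x) + psi (-1) (h3 x) + h1 x"
  "f2 (h1 x) = h1 (f2 x) + psi (-1) (f2 x)" "f2 (h3 x) = h3 (f2 x) + f2 x"
  "f2 (f1 x) = f1 (f2 x) + f3 x"
  "f3 (e1 x) = e1 (f3 x) + f2 x" "f3 (e2 x) = e2 (f3 x) + psi (-1) (f1 x)"
  "f3 (h1 x) = h1 (f3 x) + f3 x" "f3 (h3 x) = h3 (f3 x) + psi 2 (f3 x)"
  "f3 (f1 x) = f1 (f3 x)" "f3 (f2 x) = f2 (f3 x)"
  by (simp_all only: operator_zero operator_add psi_mult e1_psi e2_psi h1_psi h3_psi f1_psi f2_psi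
      f3_psi e2_e1 f3_commutation h3_commutation commutation psi_const psi_numeral)
     (simp_all add: psi_minus psi_one h3_def f3_def)

lemma collect0: "psi A x + (psi B x + z) = psi (A + B) x + z"
  by (simp add: psi_add add.assoc)

text \<open>Each application to a merging rule allows one more summand between the two terms that
  are merged.\<close>

lemma collect_step: "x + y = u + v \<Longrightarrow> x + (w + y) = u + (w + v)" for x y u v w :: 'v
  by (simp add: add.left_commute)

lemmas collect1 = collect0[THEN collect_step]
lemmas collect2 = collect1[THEN collect_step]
lemmas collect3 = collect2[THEN collect_step]
lemmas collect4 = collect3[THEN collect_step]
lemmas collect5 = collect4[THEN collect_step]
lemmas collect6 = collect5[THEN collect_step]
lemmas collect7 = collect6[THEN collect_step]
lemmas collect8 = collect7[THEN collect_step]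
lemmas collect9 = collect8[THEN collect_step]

lemmas collect = collect0 collect1 collect2 collect3 collect4 collect5 collect6 collect7 collect8
  collect9

text \<open>Splits the vanishing of a normal form into one power series identity for each ordered
  word.\<close>

lemma sum_eq_zero: "A = 0 \<Longrightarrow> y = 0 \<Longrightarrow> psi A x + y = 0"
  using psi_const[of 0 x] by simp

text \<open>Distributing \<open>psi 1\<close> over the difference gives every word an explicit
  coefficient, so that the \<open>collect\<close> rules match words that would otherwise stand
  bare.\<close>

lemma eq_by_normal_form:
  assumes "psi 1 (x - y) + 0 = 0"
  shows "x = y"
  using assms by (simp add: psi_one)

section \<open>Verification of the relations for the nonlinear map\<close>

abbreviation realization :: "complex \<Rightarrow> generator \<Rightarrow> 'v \<Rightarrow> 'v" where
  "realization h \<equiv> nonlinear_map End h psi h1 h2 e1 e2 f1 f2"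

lemma realization_closed: "realization h g \<in> carrier End"
  by (cases g)
    (simp_all add: End_closed generator_closed psi_closed a_minus_def)

text \<open>Expresses the images through \<open>h3\<close>, \<open>f3\<close> and series alone, with
  \<open>e3\<close> as \<open>psi fps_X\<close>, which is the form that the normal form rules
  expect.\<close>

lemma realization_apply:
  "realization h GT v = psi (T_series h) v"
  "realization h GTinv v = psi (Tinv_series h) v"
  "realization h GH3 v = psi (sqrt_series h) (h3 v)"
  "realization h GF3 v = f3 v - scale (h^2/4) (psi fps_X (h3 (h3 v) - v))"
  "realization h GE1 v = psi (T_half_series h) (e1 v)"
  "realization h GE2 v = psi (T_half_series h) (e2 v)"
  "realization h GF1 v =
    psi (Tinv_half_series h) (f1 v + scale (h/2) (e2 (psi (T_series h) (h3 v))))"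
  "realization h GF2 v =
    psi (Tinv_half_series h) (f2 v - scale (h/2) (e1 (psi (T_series h) (h3 v))))"
  "realization h GH1 v = h1 v - scale (h/2) (psi fps_X (psi (Tinv_series h) (h3 v)))"
  "realization h GH2 v = h2 v - scale (h/2) (psi fps_X (psi (Tinv_series h) (h3 v)))"
  by (simp_all add: End_apply End_diff_apply End_comm_apply End_square End_closed generator_closed
      psi_closed h3_def f3_def psi_X e3_apply)

text \<open>Together with \<open>fps_const_rational\<close>, this reduces the constants occurring in
  the relations to \<open>h/2\<close>, \<open>1/4\<close> and integers, so that the coefficients
  become polynomials over the integers.\<close>

lemma fps_const_h:
  fixes h :: complex
  shows "fps_const h = 2 * fps_const (h/2)" "fps_const (- h) = - 2 * fps_const (h/2)"
  "fps_const (2 * h) = 4 * fps_const (h/2)" "fps_const (- h/2) = - fps_const (h/2)"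
  "fps_const (h/4) = 2 * fps_const (h/2) * fps_const (1/4)"
  "fps_const (h/8) = fps_const (h/2) * fps_const (1/4)"
  "fps_const (h^2/4) = fps_const (h/2) * fps_const (h/2)"
  by (simp_all add: numeral_fps_const power2_eq_square)

lemma fps_const_rational:
  "fps_const (2 :: complex) = 2" "fps_const (- 2 :: complex) = - 2"
  "fps_const (1/2 :: complex) = 2 * fps_const (1/4)"
  "fps_const (- 1/2 :: complex) = - 2 * fps_const (1/4)"
  "fps_const (- 1/4 :: complex) = - fps_const (1/4)"
  by (simp_all add: numeral_fps_const)

lemmas deriv_simps = fps_deriv_series fps_deriv_numeral fps_deriv_const fps_deriv_mult fps_deriv_add
  fps_deriv_sub fps_deriv_neg fps_deriv_fps_X fps_deriv_1 fps_deriv_0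

lemma realization_relations:
  "\<forall>(l, r) \<in> set (jordanian_relations End h (h/2) (realization h)). l = r"
  \<comment> \<open>The list of relations becomes a conjunction of operator identities, each stated
    at a vector.\<close>
  apply (simp only: jordanian_relations_def relations_A_def relations_B_def relations_FF_def Let_def
      set_append ball_Un list.set ball_simps prod.case fun_eq_iff)
  apply (intro conjI allI TrueI)
  apply (simp_all only: End_apply End_minus_apply End_diff_apply End_comm_apply End_square
      End_closed realization_closed realization_apply)
  \<comment> \<open>One round per relation. Some coefficients vanish as polynomials with all series
    independent; for the others the relations between the series and the equation for
    \<open>1/4\<close> are added.\<close>
  apply (rule eq_by_normal_form; simp only: normal_form fps_const_h[of h] fps_const_rational collect;
      intro sum_eq_zero refl; (simp only: deriv_simps)?;
      (Groebner_Basis.algebra | (insert series_relations[of h] quarter, Groebner_Basis.algebra)))+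
  done

end

text \<open>Generation and the universal property together say that the quotient is the algebra
  presented by the relations, for both values of the coefficient \<open>k\<close>. The realization
  on sl(3)-modules is asserted for \<open>k = h/2\<close>.\<close>

theorem proposition1:
  fixes h :: complex
  shows "(\<forall>k \<in> {h, h/2}.
            assoc_algebra (jordanian_algebra h k) \<and>
            generates_algebra (jordanian_algebra h k) (range (jordanian_gen h k)) \<and>
            satisfies_jordanian (jordanian_algebra h k) h k (jordanian_gen h k) \<and>
            (\<forall>(A :: (complex, 'a) module) x.
               assoc_algebra A \<longrightarrow> satisfies_jordanian A h k x \<longrightarrow>
               (\<exists>\<phi> \<in> algebra_hom (jordanian_algebra h k) A. \<forall>g. \<phi> (jordanian_gen h k g) = x g)))
       \<and> (\<forall>(scale :: complex \<Rightarrow> 'v::ab_group_add \<Rightarrow> 'v) h1 h2 e1 e2 f1 f2.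
            vector_space scale \<longrightarrow>
            chevalley_sl3 (endomorphism_algebra scale) h1 h2 e1 e2 f1 f2 \<longrightarrow>
            locally_nilpotent (comm (endomorphism_algebra scale) e1 e2) \<longrightarrow>
            satisfies_jordanian (endomorphism_algebra scale) h (h/2)
              (nonlinear_map (endomorphism_algebra scale) h
                (series_at scale (comm (endomorphism_algebra scale) e1 e2)) h1 h2 e1 e2 f1 f2))"
proof (intro conjI ballI allI impI)
  fix k
  show "assoc_algebra (jordanian_algebra h k)"
    by (rule assoc_algebra_jordanian_algebra)
  show "generates_algebra (jordanian_algebra h k) (range (jordanian_gen h k))"
    by (rule jordanian_algebra_generated)
  show "satisfies_jordanian (jordanian_algebra h k) h k (jordanian_gen h k)"
    by (rule jordanian_algebra_satisfies)
  fix A :: "(complex, 'a) module" and x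
  assume "assoc_algebra A" "satisfies_jordanian A h k x"
  then show "\<exists>\<phi>\<in>algebra_hom (jordanian_algebra h k) A. \<forall>g. \<phi> (jordanian_gen h k g) = x g"
    by (rule jordanian_algebra_universal)
next
  fix scale :: "complex \<Rightarrow> 'v \<Rightarrow> 'v" and h1 h2 e1 e2 f1 f2
  let ?e3 = "comm (endomorphism_algebra scale) e1 e2"
  assume "vector_space scale"
    and chevalley: "chevalley_sl3 (endomorphism_algebra scale) h1 h2 e1 e2 f1 f2"
    and nilpotent: "locally_nilpotent ?e3"
  then interpret complex_vector_space scale
    by (simp add: complex_vector_space_def)
  \<comment> \<open>As a commutator of endomorphisms \<open>?e3\<close> is linear, which together
    with local nilpotency puts it in the setting of \<open>nilpotent_operator\<close>.\<close>
  have "Vector_Spaces.linear scale scale ?e3"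
    using chevalley_carrier[OF chevalley] by (simp add: End_comm_closed flip: End_carrier)
  with nilpotent chevalley interpret sl3_module scale ?e3 h1 h2 e1 e2 f1 f2
    by (simp add: sl3_module_def sl3_module_axioms_def nilpotent_operator_def
        nilpotent_operator_axioms_def complex_vector_space_axioms)
  show "satisfies_jordanian End h (h/2) (realization h)"
    unfolding satisfies_jordanian_def
    by (intro conjI realization_relations) (use realization_closed in blast)
qed

end
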